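(* Let $\lambda$ be a partition with $d=\ell(\lambda)$ parts and $\mu$ a partition with $[\mu]\subseteq[\lambda]$. Then $$\frac{\mathrm{rpp}_{\lambda/\mu}(q)}{\mathrm{rpp}_{\lambda}(q)}=\sum_{T\in\mathrm{SSYT}(\mu,d)}q^{p^*(T)}\prod_{u\in[\mu]}\bigl(1-q^{w(u,T(u))}\bigr),$$ where $$p^*(T)=\sum_{\substack{u\in[\mu]\\ T(u)<k\le \min(d,M_T(u))}}w(u,k)$$ and $M_T(u)$ is the maximum $k\ge T(u)$ such that replacing the entry $T(u)$ by $k$ still gives a semistandard tableau.
   Context: For $u=(i,j)$, $c(u)=j-i$ is the content, and $w(u,k)=\lambda_{d+1-k}-c(u)$. $\mathrm{SSYT}(\mu,d)$ is the set of semistandard Young tableaux of shape $\mu$ (positive integer entries, rows weakly and columns strictly increasing) with entries at most $d$. If there is no maximum in the definition of $M_T(u)$, then $M_T(u)=\infty$. A reverse plane partition of a skew shape $\theta$ is a filling of the cells of $[\theta]$ with nonnegative integers, weakly increasing along rows (left to right) and down columns; $\mathrm{rpp}_\theta(q)=\sum_T q^{|T|}$ over all reverse plane partitions $T$ of shape $\theta$, where $|T|$ is the sum of the entries. *)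

theory Defs
  imports
    "HOL-Computational_Algebra.Formal_Laurent_Series"
    "HOL-Library.FuncSet"
    "HOL-Library.Extended_Nat"
begin

definition is_partition :: "nat list \<Rightarrow> bool" where
  "is_partition lam \<longleftrightarrow> sorted_wrt (\<ge>) lam \<and> (\<forall>x\<in>set lam. 0 < x)"

text \<open>Parts are indexed from 1, and \<open>part lam i = 0\<close> for \<open>i > \<ell>(lam)\<close>.\<close>

definition part :: "nat list \<Rightarrow> nat \<Rightarrow> nat" where
  "part lam i = (if 1 \<le> i \<and> i \<le> length lam then lam ! (i - 1) else 0)"

type_synonym cell = "nat \<times> nat"

text \<open>A cell is a pair (row, column), both counted from 1.\<close>

definition diagram :: "nat list \<Rightarrow> cell set" where
  "diagram lam = {(i, j). 1 \<le> i \<and> i \<le> length lam \<and> 1 \<le> j \<and> j \<le> part lam i}"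

definition skew_diagram :: "nat list \<Rightarrow> nat list \<Rightarrow> cell set" where
  "skew_diagram lam \<mu> = diagram lam - diagram \<mu>"

definition content :: "cell \<Rightarrow> int" where
  "content u = int (snd u) - int (fst u)"

text \<open>
  Fillings of a shape are extensional functions on its set of cells, so that distinct functions
  are distinct fillings.
\<close>

definition RPP :: "cell set \<Rightarrow> (cell \<Rightarrow> nat) set" where
  "RPP \<theta> = {T \<in> \<theta> \<rightarrow>\<^sub>E UNIV.
     (\<forall>i j j'. (i, j) \<in> \<theta> \<and> (i, j') \<in> \<theta> \<and> j < j' \<longrightarrow> T (i, j) \<le> T (i, j')) \<and>
     (\<forall>i i' j. (i, j) \<in> \<theta> \<and> (i', j) \<in> \<theta> \<and> i < i' \<longrightarrow> T (i, j) \<le> T (i', j))}"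

text \<open>The generating function \<open>\<Sum>T. q^|T|\<close>: the coefficient of \<open>q^n\<close> counts the \<open>T\<close> with \<open>|T| = n\<close>.\<close>

definition rpp :: "cell set \<Rightarrow> rat fps" where
  "rpp \<theta> = Abs_fps (\<lambda>n. of_nat (card {T \<in> RPP \<theta>. (\<Sum>u\<in>\<theta>. T u) = n}))"

definition is_ssyt :: "nat list \<Rightarrow> (cell \<Rightarrow> nat) \<Rightarrow> bool" where
  "is_ssyt \<mu> T \<longleftrightarrow> T \<in> diagram \<mu> \<rightarrow>\<^sub>E {0<..} \<and>
     (\<forall>i j j'. (i, j) \<in> diagram \<mu> \<and> (i, j') \<in> diagram \<mu> \<and> j < j' \<longrightarrow> T (i, j) \<le> T (i, j')) \<and>
     (\<forall>i i' j. (i, j) \<in> diagram \<mu> \<and> (i', j) \<in> diagram \<mu> \<and> i < i' \<longrightarrow> T (i, j) < T (i', j))"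

definition SSYT :: "nat list \<Rightarrow> nat \<Rightarrow> (cell \<Rightarrow> nat) set" where
  "SSYT \<mu> d = {T. is_ssyt \<mu> T \<and> (\<forall>u\<in>diagram \<mu>. T u \<le> d)}"

text \<open>
  The candidates \<open>k\<close> are not bounded by \<open>d\<close>; the set of candidates contains \<open>T u\<close>, so it has no
  maximum precisely when it is infinite.
\<close>

definition max_entry :: "nat list \<Rightarrow> (cell \<Rightarrow> nat) \<Rightarrow> cell \<Rightarrow> enat" where
  "max_entry \<mu> T u =
     (let K = {k. T u \<le> k \<and> is_ssyt \<mu> (T(u := k))}
      in if finite K then enat (Max K) else \<infinity>)"

text \<open>
  Weights can be negative, so powers of \<open>q\<close> are taken in Laurent series. The difference
  \<open>d + 1 - k\<close> is never truncated where the weight is used (\<open>1 \<le> k \<le> d\<close>).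
\<close>

definition weight :: "nat list \<Rightarrow> cell \<Rightarrow> nat \<Rightarrow> int" where
  "weight lam u k = int (part lam (length lam + 1 - k)) - content u"

definition pstar :: "nat list \<Rightarrow> nat list \<Rightarrow> (cell \<Rightarrow> nat) \<Rightarrow> int" where
  "pstar lam \<mu> T =
     (\<Sum>u\<in>diagram \<mu>.
        \<Sum>k | T u < k \<and> enat k \<le> min (enat (length lam)) (max_entry \<mu> T u). weight lam u k)"

end

theory Submission
  imports Defs
begin

text \<open>Both sides, as functions of \<open>\<mu>\<close>, satisfy the same linear recurrence. Let \<open>\<mu> + S\<close> denote the shape obtained from
\<open>\<mu>\<close> by adding the boxes of a set \<open>S\<close> of addable corners. The recurrence is
\<open>(\<Sum>S. (-1) ^ |S| * H (\<mu> + S)) = q ^ (|\<lambda>| - |\<mu>|) * H \<mu>\<close>.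
A solution that is \<open>0\<close> outside \<open>\<lambda>\<close> is determined by its value at \<open>\<lambda>\<close>: for \<open>\<mu>\<close> strictly inside \<open>\<lambda>\<close> the power
of \<open>q\<close> on the right is not \<open>1\<close>, so that \<open>H(\<mu>)\<close> is expressed by larger shapes
(\<open>recurrence_determines\<close>). Hence two such solutions are proportional, and evaluation at the empty
shape fixes the factor: there the tableau sum is \<open>1\<close> and the generating function is that of \<open>\<lambda>\<close>.

For reverse plane partitions the recurrence is inclusion and exclusion over the addable corners,
which are the minimal cells of \<open>\<lambda>/\<mu>\<close>. Setting the corners in \<open>S\<close> to zero leaves an arbitrary reverse
plane partition of \<open>\<lambda>/(\<mu> + S)\<close>; if no corner is zero, then no entry is zero, and subtracting \<open>1\<close>
everywhere gives the factor \<open>q\<close> to the number of cells (\<open>rpp_skew_recurrence\<close>).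

For tableaux the recurrence is a Chevalley rule of factorial Grothendieck type, proved by induction
on the bound \<open>d\<close> for the entries (\<open>tabsum_chevalley\<close>). Arbitrary integers \<open>a 1, \<dots>, a d\<close> take the place
of the parts of \<open>\<lambda>\<close>; the induction adds the variable \<open>a (d + 1)\<close>. Deleting the entries \<open>d + 1\<close>
removes a horizontal strip, and the weight of a tableau then splits off a factor that only depends
on the two shapes (\<open>tabsum_branching\<close>). The induction step therefore reduces to an identity for this
kernel, in which adding corners to the outer shape is traded for removing corners from the inner
one (\<open>kernel_commutation\<close>). The kernel is a product of factors that see only two consecutive
parts, and the identity follows by telescoping from a statement about two adjacent rows
(\<open>adjacent_rows_identity\<close>).

The tableau sum is \<open>0\<close> for shapes not contained in \<open>\<lambda>\<close>, because the first row of every tableau then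
contains a cell of weight \<open>0\<close> (\<open>tabsum_vanishes\<close>).
\<close>

section \<open>Shapes as functions on rows\<close>

text \<open>
Partitions with at most \<open>d\<close> parts, as functions on row numbers that start at \<open>1\<close>. The value at \<open>0\<close> is
pinned down so that equality of functions is equality of partitions; consequently monotonicity is
only available from row \<open>1\<close> on.
\<close>

definition shapes :: "nat \<Rightarrow> (nat \<Rightarrow> nat) set" where
  "shapes d = {m. m 0 = 0 \<and> (\<forall>i\<ge>1. m (Suc i) \<le> m i) \<and> (\<forall>i>d. m i = 0)}"

text \<open>
Corners are recorded by their rows. Rows beyond \<open>d\<close> are left out: a tableau with entries at most \<open>d\<close>
has no row \<open>d + 1\<close>, so a corner there would contribute nothing to a tableau sum.
\<close>

definition add_rows :: "nat \<Rightarrow> (nat \<Rightarrow> nat) \<Rightarrow> nat set" where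
  "add_rows d m = {i \<in> {1..d}. i = 1 \<or> m i < m (i - 1)}"

definition rem_rows :: "nat \<Rightarrow> (nat \<Rightarrow> nat) \<Rightarrow> nat set" where
  "rem_rows d m = {i \<in> {1..d}. m (Suc i) < m i}"

definition grow :: "(nat \<Rightarrow> nat) \<Rightarrow> nat set \<Rightarrow> nat \<Rightarrow> nat" where
  "grow m S = (\<lambda>i. m i + of_bool (i \<in> S))"

definition shrink :: "(nat \<Rightarrow> nat) \<Rightarrow> nat set \<Rightarrow> nat \<Rightarrow> nat" where
  "shrink m S = (\<lambda>i. m i - of_bool (i \<in> S))"

definition ncells :: "nat \<Rightarrow> (nat \<Rightarrow> nat) \<Rightarrow> nat" where
  "ncells d m = (\<Sum>i=1..d. m i)"

definition cells :: "(nat \<Rightarrow> nat) \<Rightarrow> cell set" where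
  "cells m = {(i, j). 1 \<le> j \<and> j \<le> m i}"

lemma shapes_antimono:
  assumes "m \<in> shapes d" "1 \<le> i" "i \<le> i'"
  shows "m i' \<le> m i"
  using assms(3)
proof (induction i' rule: dec_induct)
  case (step n)
  then have "m (Suc n) \<le> m n" using assms by (auto simp: shapes_def)
  with step show ?case by auto
qed simp

lemma cells_Sigma: "m \<in> shapes d \<Longrightarrow> cells m = Sigma {1..d} (\<lambda>i. {1..m i})"
  unfolding cells_def shapes_def
  by (auto simp: Suc_le_eq intro!: gr0I) (metis not_le_imp_less not_less0 not_less le_zero_eq)+

lemma finite_cells: "m \<in> shapes d \<Longrightarrow> finite (cells m)"
  by (simp add: cells_Sigma)

lemma finite_bounded_shapes: "finite {k \<in> shapes d. \<forall>i. k i \<le> (N::nat)}"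
proof (rule finite_subset)
  show "{k \<in> shapes d. \<forall>i. k i \<le> N} \<subseteq> {f. \<forall>i. (i \<in> {1..d} \<longrightarrow> f i \<in> {..N}) \<and> (i \<notin> {1..d} \<longrightarrow> f i = 0)}"
    unfolding shapes_def by (auto simp: not_le Suc_le_eq)
  show "finite {f. \<forall>i. (i \<in> {1..d} \<longrightarrow> f i \<in> {..N}) \<and> (i \<notin> {1..d} \<longrightarrow> f i = (0::nat))}"
    by (rule finite_set_of_finite_funs) auto
qed

lemma shapes_le_first: "m \<in> shapes d \<Longrightarrow> m i \<le> m 1"
  by (cases "i = 0") (auto simp: shapes_antimono, simp add: shapes_def)

lemma cells_mono_iff: "m 0 = 0 \<Longrightarrow> cells m \<subseteq> cells L \<longleftrightarrow> (\<forall>i. m i \<le> L i)"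
proof
  assume sub: "cells m \<subseteq> cells L"
  show "\<forall>i. m i \<le> L i"
  proof
    fix i show "m i \<le> L i"
    proof (cases "m i = 0")
      case False
      then have "(i, m i) \<in> cells m" by (auto simp: cells_def)
      with sub show ?thesis by (auto simp: cells_def)
    qed simp
  qed
qed (auto simp: cells_def intro: order_trans)

lemma card_cells: "m \<in> shapes d \<Longrightarrow> card (cells m) = ncells d m"
  by (simp add: cells_Sigma ncells_def)

lemma grow_shapes:
  assumes m: "m \<in> shapes d" and S: "S \<subseteq> add_rows d m"
  shows "grow m S \<in> shapes d"
proof -
  have "grow m S (Suc i) \<le> grow m S i" if "1 \<le> i" for i
  proof (cases "Suc i \<in> S")
    case True
    then have "Suc i \<in> add_rows d m" using S by blast
    with that show ?thesis by (auto simp: add_rows_def grow_def)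
  next
    case False
    moreover have "m (Suc i) \<le> m i" using m that by (simp add: shapes_def)
    ultimately show ?thesis by (simp add: grow_def)
  qed
  moreover have "i \<in> {1..d}" if "i \<in> S" for i using S that by (auto simp: add_rows_def)
  ultimately show ?thesis using m by (fastforce simp: shapes_def grow_def)
qed

lemma shrink_shapes:
  assumes m: "m \<in> shapes d" and S: "S \<subseteq> rem_rows d m"
  shows "shrink m S \<in> shapes d"
proof -
  have "shrink m S (Suc i) \<le> shrink m S i" if "1 \<le> i" for i
  proof (cases "i \<in> S")
    case True
    then have "i \<in> rem_rows d m" using S by blast
    then show ?thesis by (auto simp: rem_rows_def shrink_def)
  next
    case False
    moreover have "m (Suc i) \<le> m i" using m that by (simp add: shapes_def)
    ultimately show ?thesis by (simp add: shrink_def)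
  qed
  then show ?thesis using m by (simp add: shapes_def) (simp add: shrink_def)
qed

text \<open>
Together with \<open>shrink_addable\<close>, \<open>shrink_grow\<close> and \<open>grow_shrink\<close> this makes \<open>(m, S)\<close> and \<open>(grow m S, S)\<close>
correspond bijectively; the Chevalley rule uses this to turn removals from the inner shape back into
additions.
\<close>

lemma grow_removable:
  assumes m: "m \<in> shapes d" and S: "S \<subseteq> add_rows d m"
  shows "S \<subseteq> rem_rows d (grow m S)"
proof
  fix i assume i: "i \<in> S"
  then have i1: "i \<in> {1..d}" using S by (auto simp: add_rows_def)
  then have "m (Suc i) \<le> m i" using m by (simp add: shapes_def)
  moreover have "m (Suc i) < m i" if "Suc i \<in> S"
    using subsetD[OF S that] i1 by (auto simp: add_rows_def)
  ultimately show "i \<in> rem_rows d (grow m S)" using i i1 by (auto simp: rem_rows_def grow_def)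
qed

lemma shrink_addable:
  assumes m: "m \<in> shapes d" and S: "S \<subseteq> rem_rows d m"
  shows "S \<subseteq> add_rows d (shrink m S)"
proof
  fix i assume i: "i \<in> S"
  then have i1: "i \<in> {1..d}" and mi: "m (Suc i) < m i" using S by (auto simp: rem_rows_def)
  have "shrink m S i < shrink m S (i - 1)" if ne: "i \<noteq> 1"
  proof -
    have i': "Suc (i - 1) = i" "1 \<le> i - 1" using i1 ne by auto
    have "m i \<le> m (i - 1)" using m i' by (metis (mono_tags, lifting) shapes_def mem_Collect_eq)
    moreover have "m i < m (i - 1)" if "i - 1 \<in> S"
      using subsetD[OF S that] i' by (auto simp: rem_rows_def)
    ultimately show ?thesis using i mi by (auto simp: shrink_def)
  qed
  then show "i \<in> add_rows d (shrink m S)" using i1 by (auto simp: add_rows_def)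
qed

lemma shrink_grow: "shrink (grow m S) S = m"
  by (auto simp: shrink_def grow_def)

lemma grow_shrink:
  assumes "S \<subseteq> rem_rows d m"
  shows "grow (shrink m S) S = m"
proof
  fix i show "grow (shrink m S) S i = m i"
    using subsetD[OF assms, of i] by (cases "i \<in> S") (auto simp: shrink_def grow_def rem_rows_def)
qed

lemma ncells_grow:
  assumes "S \<subseteq> {1..d}"
  shows "ncells d (grow m S) = ncells d m + card S"
proof -
  have "(\<Sum>i=1..d. of_bool (i \<in> S)) = card S"
    using assms by (simp add: Int_absorb1 of_bool_def sum.If_cases)
  then show ?thesis by (simp add: ncells_def grow_def sum.distrib)
qed

section \<open>Row and corner factors\<close>

text \<open>
The factors of the weight that come from the entries equal to \<open>d + 1\<close>, with \<open>x = q powi a (d + 1)\<close>.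
Such entries fill the cells \<open>k + 1, \<dots>, n\<close> of row \<open>i\<close>, and \<open>strip\<close> is the product of their weight
factors. The value \<open>0\<close> for \<open>k > n\<close> encodes that the inner shape must lie in the outer one.
\<close>

definition strip :: "'a::field \<Rightarrow> 'a \<Rightarrow> nat \<Rightarrow> nat \<Rightarrow> nat \<Rightarrow> 'a" where
  "strip q x i k n = (if k \<le> n then \<Prod>j\<in>{k<..n}. 1 - x * q powi (int i - int j) else 0)"

text \<open>
If row \<open>i\<close> of the inner shape has length \<open>k\<close> and row \<open>i + 1\<close> of the outer shape has length \<open>n\<close>, the
last inner cell of row \<open>i\<close> can be raised to \<open>d + 1\<close> exactly if \<open>n < k\<close>, and it then contributes its
power of \<open>q\<close>. The value \<open>0\<close> for \<open>k < n\<close> encodes the horizontal strip condition.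
\<close>

definition corner :: "'a::field \<Rightarrow> 'a \<Rightarrow> nat \<Rightarrow> nat \<Rightarrow> nat \<Rightarrow> 'a" where
  "corner q x i k n = (if n < k then x * q powi (int i - int k) else if n = k then 1 else 0)"

text \<open>
The telescoping factor between adjacent rows. The second case occurs when the inner row is longer
than the outer one by one cell. Then one side of the kernel identity has to add a cell to the outer
row and the other side has to remove one from the inner row, and the value compensates the
sign and the monomial by which these two changes differ.
\<close>

definition signed_strip :: "'a::field \<Rightarrow> 'a \<Rightarrow> nat \<Rightarrow> nat \<Rightarrow> nat \<Rightarrow> 'a" where
  "signed_strip q x i k n = (if k = Suc n then - inverse (x * q powi (int i - int k)) else strip q x i k n)"

lemma strip_Suc: "k \<le> n \<Longrightarrow> strip q x i k (Suc n) = strip q x i k n * (1 - x * q powi (int i - int (Suc n)))"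
proof -
  assume "k \<le> n"
  then have "{k<..Suc n} = insert (Suc n) {k<..n}" by auto
  with \<open>k \<le> n\<close> show ?thesis by (simp add: strip_def mult.commute)
qed

lemma strip_pred: "k \<le> n \<Longrightarrow> 0 < k \<Longrightarrow> strip q x i (k - 1) n = (1 - x * q powi (int i - int k)) * strip q x i k n"
proof -
  assume "k \<le> n" "0 < k"
  then have "{k - 1<..n} = insert k {k<..n}" by auto
  with \<open>k \<le> n\<close> show ?thesis by (simp add: strip_def)
qed

lemma strip_same [simp]: "strip q x i k k = 1" by (simp add: strip_def)
lemma strip_0 [simp]: "n < k \<Longrightarrow> strip q x i k n = 0" by (simp add: strip_def)

text \<open>
Here \<open>k\<close>, \<open>k'\<close> are the lengths of rows \<open>i\<close>, \<open>i + 1\<close> of the inner shape and \<open>n\<close>, \<open>n'\<close> those of the outer shape.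
On the left row \<open>i + 1\<close> of the outer shape may grow, on the right row \<open>i\<close> of the inner shape may
shrink. The main case is \<open>k \<ge> n' + 2\<close>: both differences then collapse to a single product, because
\<open>y - (1 - z) * y = z * y\<close>. The boundary cases are those in which growing or shrinking changes the
case of a corner factor, or in which the two shapes fail to interlace by one cell.
\<close>

lemma adjacent_rows_identity:
  fixes q x :: "'a::field"
  assumes q: "q \<noteq> 0" and x: "x \<noteq> 0" and kk: "k' \<le> k" and nn: "n' \<le> n"
  shows "signed_strip q x i k n *
     (strip q x (Suc i) k' n' * corner q x i k n' -
       (if n' < n then strip q x (Suc i) k' (Suc n') * corner q x i k (Suc n') else 0)) =
     (strip q x i k n * corner q x i k n' -
       (if k' < k then inverse q * strip q x i (k - 1) n * corner q x i (k - 1) n' else 0)) *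
     q powi (int k - int n') * signed_strip q x (Suc i) k' n'"
proof -
  \<comment> \<open>All exponents are absorbed into \<open>z j\<close>, the weight monomial of cell \<open>(i, j)\<close>; the cell below has
    \<open>q * z j\<close>, and the remaining power of \<open>q\<close> is a quotient of two such monomials.\<close>
  define z where "z = (\<lambda>j. x * q powi (int i - int j))"
  have z0: "z j \<noteq> 0" for j using q x by (simp add: z_def)
  have zS: "z j = q * z (Suc j)" for j
    using power_int_add[of q 1 "int i - int (Suc j)"] q by (simp add: z_def)
  have zf: "x * q powi (int i - int j) = z j" for j by (simp add: z_def)
  have zf': "x * q powi (int (Suc i) - int j) = q * z j" for j
    using power_int_add[of q 1 "int i - int j"] q by (simp add: z_def add.commute add_diff_eq)
  have qz: "q powi (int u - int v) = z v / z u" for u v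
    using q x by (simp add: z_def power_int_diff)
  note z_fold = zf zf'
  note qz_inst = qz[of k n'] qz[of "Suc n'" n'] qz[of "Suc n" n']
  consider "k < n'" | "k = n'" | "k = Suc n'" | "k > Suc n'" by linarith
  then show ?thesis
  proof cases
    case 1
    then show ?thesis by (simp add: corner_def)
  next
    case 2
    then show ?thesis using kk nn z0
      by (auto simp: corner_def signed_strip_def)
  next
    case 3
    show ?thesis
    proof (cases "k' = k")
      case True
      with 3 nn kk z0 q zS[of n'] show ?thesis
        by (auto simp: corner_def signed_strip_def z_fold qz_inst field_simps simp del: of_nat_Suc)
    next
      case False
      then have k': "k' \<le> n'" using kk 3 by simp
      show ?thesis
      proof (cases "n = n'")
        case True
        with 3 k' z0 q show ?thesis
          by (auto simp: corner_def signed_strip_def z_fold qz_inst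
              simp del: of_nat_Suc simp add: zS[of n'] field_simps)
      next
        case False
        with nn 3 have sp: "strip q x i n' n = (1 - z (Suc n')) * strip q x i (Suc n') n"
          using strip_pred[of "Suc n'" n q x i] by (simp add: z_def)
        from False 3 k' nn z0 q show ?thesis
          by (auto simp: corner_def signed_strip_def z_fold qz[of "Suc n'" n'] strip_Suc sp zS[of n']
              simp del: of_nat_Suc) (simp add: field_simps)
      qed
    qed
  next
    case 4
    have cor: "corner q x i k n' = z k" "corner q x i k (Suc n') = z k"
        "corner q x i (k - Suc 0) n' = q * z k"
      using 4 zS[of "k - 1"] by (simp_all add: corner_def z_def)
    consider "k' \<le> n'" | "k' = Suc n'" | "Suc n' < k'" by linarith
    note k'c = this
    consider "k \<le> n" | "k = Suc n" | "Suc n < k" by linarith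
    then show ?thesis
    proof cases
      case 1
      have sp: "strip q x i (k - Suc 0) n = (1 - z k) * strip q x i k n"
        using strip_pred[OF 1, of q x i] 4 by (simp add: z_def)
      from k'c show ?thesis
        using 1 4 kk nn z0 q
        by cases (auto simp: sp cor signed_strip_def z_fold qz_inst
              simp del: of_nat_Suc simp add: zS[of n'] strip_Suc field_simps)
    next
      case 2
      have "n' < n" using 2 4 by simp
      with k'c show ?thesis using 2
        using 4 kk nn z0 q
        by cases (auto simp: cor[unfolded 2, simplified] signed_strip_def z_fold qz_inst
              simp del: of_nat_Suc simp add: zS[of n'] strip_Suc field_simps)
    next
      case 3
      with k'c show ?thesis
        using 4 kk nn z0 q
        by cases (auto simp: cor signed_strip_def)
    qed
  qed
qed

section \<open>The commutation identity for the branching kernel\<close>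

text \<open>
The kernel of the branching rule. Row \<open>d + 1\<close> of the inner shape \<open>k\<close> is empty, so there is one corner
factor fewer than there are strip factors.
\<close>

definition branch :: "'a::field \<Rightarrow> 'a \<Rightarrow> nat \<Rightarrow> (nat \<Rightarrow> nat) \<Rightarrow> (nat \<Rightarrow> nat) \<Rightarrow> 'a" where
  "branch q x d m k = (\<Prod>i=1..Suc d. strip q x i (k i) (m i)) *
     (\<Prod>i=1..d. corner q x i (k i) (m (Suc i)))"

text \<open>
An alternating sum over sets of corners of a product over rows factors row by row. This is what
makes the kernel identity local.
\<close>

lemma alternating_sum_prod:
  fixes f :: "'b \<Rightarrow> bool \<Rightarrow> 'a::comm_ring_1"
  assumes I: "finite I" and A: "A \<subseteq> I"
  shows "(\<Sum>S\<in>Pow A. (-1) ^ card S * (\<Prod>i\<in>I. f i (i \<in> S))) =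
    (\<Prod>i\<in>I. f i False - (if i \<in> A then f i True else 0))"
proof -
  have fA: "finite A" using A I finite_subset by blast
  have split: "prod g I = prod g A * prod g (I - A)" for g :: "'b \<Rightarrow> 'a"
    using prod.subset_diff[OF A I, of g] by (simp add: mult.commute)
  have "(\<Prod>i\<in>I. f i (i \<in> S)) =
      (\<Prod>i\<in>S. f i True) * (\<Prod>i\<in>A - S. f i False) * (\<Prod>i\<in>I - A. f i False)" if "S \<in> Pow A" for S
  proof -
    have "(\<Prod>i\<in>A. f i (i \<in> S)) = (\<Prod>i\<in>A - S. f i (i \<in> S)) * (\<Prod>i\<in>S. f i (i \<in> S))"
      using prod.subset_diff[of S A "\<lambda>i. f i (i \<in> S)"] fA that by simp
    moreover have "(\<Prod>i\<in>A - S. f i (i \<in> S)) = (\<Prod>i\<in>A - S. f i False)"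
      "(\<Prod>i\<in>S. f i (i \<in> S)) = (\<Prod>i\<in>S. f i True)" by (auto intro!: prod.cong)
    moreover have "(\<Prod>i\<in>I - A. f i (i \<in> S)) = (\<Prod>i\<in>I - A. f i False)"
      using that by (intro prod.cong refl) (auto intro: arg_cong)
    ultimately show ?thesis by (simp only: split mult_ac)
  qed
  then have "(\<Sum>S\<in>Pow A. (-1) ^ card S * (\<Prod>i\<in>I. f i (i \<in> S))) =
     (\<Sum>S\<in>Pow A. (-1) ^ card S * (\<Prod>i\<in>S. f i True) * (\<Prod>i\<in>A - S. f i False)) *
       (\<Prod>i\<in>I - A. f i False)"
    unfolding sum_distrib_right by (intro sum.cong refl) (simp add: mult_ac)
  also have "\<dots> = (\<Prod>i\<in>A. f i False - f i True) * (\<Prod>i\<in>I - A. f i False)"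
    by (simp add: prod_diff_conv_sum[OF fA])
  also have "\<dots> = (\<Prod>i\<in>I. f i False - (if i \<in> A then f i True else 0))"
    unfolding split by (intro arg_cong2[where f = times] prod.cong) auto
  finally show ?thesis .
qed

lemma prod_head_shift: "prod f {1..Suc d} = f 1 * (\<Prod>i=1..d. f (Suc i))"
  for f :: "nat \<Rightarrow> 'a::comm_monoid_mult"
  by (subst prod.atLeast_Suc_atMost) (simp_all add: prod.shift_bounds_cl_Suc_ivl del: prod.cl_ivl_Suc)

text \<open>
Both sides are products over rows by \<open>alternating_sum_prod\<close>. Left and right factors do not agree row
by row, but they differ by a quotient of consecutive values of \<open>signed_strip\<close>, which cancels in the
product.
\<close>

lemma kernel_commutation:
  fixes q x :: "'a::field"
  assumes q: "q \<noteq> 0" and x: "x \<noteq> 0" and m: "m \<in> shapes (Suc d)" and k: "k \<in> shapes d"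
  shows "(\<Sum>S\<in>Pow (add_rows (Suc d) m). (-1) ^ card S * branch q x d (grow m S) k) =
    x * q powi (- int (ncells (Suc d) m)) *
    (\<Sum>S\<in>Pow (rem_rows d k). (-1) ^ card S * (q powi (int (ncells d k) - int (card S)) *
        branch q x d m (shrink k S)))"
proof -
  define Lf where "Lf i b = strip q x i (k i) (m i + of_bool b) *
     (if i = 1 then 1 else corner q x (i - 1) (k (i - 1)) (m i + of_bool b))" for i b
  define L where "L i = Lf i False - (if i \<in> add_rows (Suc d) m then Lf i True else 0)" for i
  define Rf where "Rf i b = (if b then inverse q else 1) * (strip q x i (k i - of_bool b) (m i) *
     corner q x i (k i - of_bool b) (m (Suc i)))" for i b
  define R where "R i = Rf i False - (if i \<in> rem_rows d k then Rf i True else 0)" for i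
  define s where "s i = signed_strip q x i (k i) (m i)" for i
  have "branch q x d (grow m S) k = (\<Prod>i\<in>{1..Suc d}. Lf i (i \<in> S))" for S
    unfolding prod_head_shift branch_def Lf_def grow_def by (simp add: prod.distrib mult_ac)
  then have "(\<Sum>S\<in>Pow (add_rows (Suc d) m). (-1) ^ card S * branch q x d (grow m S) k) =
      (\<Prod>i\<in>{1..Suc d}. L i)"
    unfolding L_def by (simp only:) (rule alternating_sum_prod, auto simp: add_rows_def)
  also have "\<dots> = L 1 * (\<Prod>i=1..d. L (Suc i))" by (rule prod_head_shift)
  \<comment> \<open>Row \<open>1\<close> has no row above it; it starts the telescoping and supplies the factor \<open>x\<close>.\<close>
  also have "L 1 = x * q powi (- int (m 1)) * s 1"
  proof -
    have "L 1 = strip q x 1 (k 1) (m 1) - strip q x 1 (k 1) (Suc (m 1))"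
      by (simp add: L_def Lf_def add_rows_def)
    moreover have "strip q x 1 (k 1) (m 1) - strip q x 1 (k 1) (Suc (m 1)) =
        x * q powi (- int (m 1)) * s 1"
    proof -
      consider "k 1 \<le> m 1" | "k 1 = Suc (m 1)" | "Suc (m 1) < k 1" by linarith
      then show ?thesis
      proof cases
        case 1
        then show ?thesis unfolding s_def signed_strip_def strip_Suc[OF 1]
          by (simp add: algebra_simps)
      next
        case 2
        then show ?thesis using q x unfolding s_def signed_strip_def by (simp add: divide_simps)
      next
        case 3
        then show ?thesis by (simp add: s_def signed_strip_def)
      qed
    qed
    ultimately show ?thesis by simp
  qed
  finally have lhs: "(\<Sum>S\<in>Pow (add_rows (Suc d) m). (-1) ^ card S * branch q x d (grow m S) k) =
     x * q powi (- int (m 1)) * (s 1 * (\<Prod>i=1..d. L (Suc i)))" by (simp only: mult_ac)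
  have local_step: "s i * L (Suc i) = R i * q powi (int (k i) - int (m (Suc i))) * s (Suc i)"
    if "i \<in> {1..d}" for i
  proof -
    have "k (Suc i) \<le> k i" "m (Suc i) \<le> m i" using that m k by (auto simp: shapes_def)
    note id = adjacent_rows_identity[OF q x this, of i]
    have "L (Suc i) = strip q x (Suc i) (k (Suc i)) (m (Suc i)) * corner q x i (k i) (m (Suc i)) -
       (if m (Suc i) < m i then strip q x (Suc i) (k (Suc i)) (Suc (m (Suc i))) *
          corner q x i (k i) (Suc (m (Suc i))) else 0)"
      using that by (simp add: L_def Lf_def add_rows_def)
    moreover have "R i = strip q x i (k i) (m i) * corner q x i (k i) (m (Suc i)) -
       (if k (Suc i) < k i then inverse q * strip q x i (k i - 1) (m i) *
          corner q x i (k i - 1) (m (Suc i)) else 0)"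
      using that by (simp add: R_def Rf_def rem_rows_def)
    ultimately show ?thesis using id unfolding s_def by simp
  qed
  have tele: "n \<le> d \<Longrightarrow> s 1 * (\<Prod>i=1..n. L (Suc i)) =
      (\<Prod>i=1..n. R i * q powi (int (k i) - int (m (Suc i)))) * s (Suc n)" for n
  proof (induction n)
    case (Suc n)
    have "s 1 * (\<Prod>i=1..Suc n. L (Suc i)) = (s 1 * (\<Prod>i=1..n. L (Suc i))) * L (Suc (Suc n))"
      by (simp add: mult_ac)
    also have "\<dots> = (\<Prod>i=1..n. R i * q powi (int (k i) - int (m (Suc i)))) * (s (Suc n) * L (Suc (Suc n)))"
      using Suc by (simp only: mult_ac Suc_leD)
    also have "\<dots> = (\<Prod>i=1..Suc n. R i * q powi (int (k i) - int (m (Suc i)))) * s (Suc (Suc n))"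
      using Suc.prems by (subst local_step) (simp_all add: mult_ac)
    finally show ?case .
  qed simp
  have qadd: "q powi (a + b) = q powi a * q powi b" for a b
    using q by (simp add: power_int_add)
  have qsum: "q powi (\<Sum>i\<in>I. g i) = (\<Prod>i\<in>I. q powi (g i))" if "finite I" for g and I :: "nat set"
    using that by (induction) (simp_all add: qadd)
  have kd: "k (Suc d) = 0" using k by (simp add: shapes_def)
  \<comment> \<open>Row \<open>d + 1\<close> of \<open>k\<close> is empty and cannot exceed that of \<open>m\<close>, so the telescoping ends in an honest strip factor.\<close>
  have sd: "s (Suc d) = strip q x (Suc d) (k (Suc d)) (m (Suc d))"
    using kd by (simp add: s_def signed_strip_def)
  have rhs_term: "q powi (int (ncells d k) - int (card S)) * branch q x d m (shrink k S) =
     q powi (int (ncells d k)) * s (Suc d) * (\<Prod>i\<in>{1..d}. Rf i (i \<in> S))"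
    if S: "S \<in> Pow (rem_rows d k)" for S
  proof -
    have Sd: "S \<subseteq> {1..d}" using S by (auto simp: rem_rows_def)
    have "q powi (- int (card S)) = (\<Prod>i\<in>{1..d}. if i \<in> S then inverse q else 1)"
      using Sd by (simp add: prod.If_cases Int_absorb1 power_int_minus flip: power_inverse)
    moreover have "Suc d \<notin> S" using Sd by auto
    ultimately show ?thesis
      unfolding branch_def Rf_def prod.distrib sd diff_conv_add_uminus qadd
      by (simp add: shrink_def mult_ac)
  qed
  have "(\<Sum>S\<in>Pow (rem_rows d k). (-1) ^ card S * (q powi (int (ncells d k) - int (card S)) *
        branch q x d m (shrink k S))) =
      (\<Sum>S\<in>Pow (rem_rows d k). (-1) ^ card S * (\<Prod>i\<in>{1..d}. Rf i (i \<in> S))) *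
        (q powi (int (ncells d k)) * s (Suc d))"
    unfolding sum_distrib_right by (intro sum.cong refl) (simp only: rhs_term, simp only: mult_ac)
  also have "(\<Sum>S\<in>Pow (rem_rows d k). (-1) ^ card S * (\<Prod>i\<in>{1..d}. Rf i (i \<in> S))) =
      (\<Prod>i=1..d. R i)"
    unfolding R_def by (rule alternating_sum_prod) (auto simp: rem_rows_def)
  finally have rhs: "(\<Sum>S\<in>Pow (rem_rows d k). (-1) ^ card S * (q powi (int (ncells d k) - int (card S)) *
        branch q x d m (shrink k S))) = (\<Prod>i=1..d. R i) * (q powi (int (ncells d k)) * s (Suc d))" .
  \<comment> \<open>The powers of \<open>q\<close> collected along the rows add up to the difference of the sizes.\<close>
  have "(\<Sum>i=1..d. int (k i) - int (m (Suc i))) - int (m 1) =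
      int (ncells d k) - int (ncells (Suc d) m)"
  proof -
    have "ncells (Suc d) m = m 1 + (\<Sum>i=1..d. m (Suc i))"
      unfolding ncells_def
      by (subst sum.atLeast_Suc_atMost) (simp_all add: sum.shift_bounds_cl_Suc_ivl del: sum.cl_ivl_Suc)
    then show ?thesis by (simp add: sum_subtractf ncells_def)
  qed
  then have "q powi (- int (m 1)) * q powi (\<Sum>i=1..d. int (k i) - int (m (Suc i))) =
      q powi (- int (ncells (Suc d) m)) * q powi (int (ncells d k))"
    unfolding qadd[symmetric] by (intro arg_cong[where f = "\<lambda>e. q powi e"]) linarith
  then show ?thesis
    unfolding lhs rhs tele[OF order_refl] prod.distrib qsum[symmetric, OF finite_atLeastAtMost]
    by (simp only: mult_ac)
qed

section \<open>Tableaux and their branching\<close>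

text \<open>
Semistandard fillings on an arbitrary set of cells, so that a tableau can be restricted to a smaller
shape without changing type.
\<close>

definition tabs :: "nat \<Rightarrow> cell set \<Rightarrow> (cell \<Rightarrow> nat) set" where
  "tabs d D = {T \<in> D \<rightarrow>\<^sub>E {1..d}.
     (\<forall>i j j'. (i, j) \<in> D \<and> (i, j') \<in> D \<and> j < j' \<longrightarrow> T (i, j) \<le> T (i, j')) \<and>
     (\<forall>i i' j. (i, j) \<in> D \<and> (i', j) \<in> D \<and> i < i' \<longrightarrow> T (i, j) < T (i', j))}"

text \<open>
For a tableau \<open>T\<close> and \<open>k \<ge> T u\<close> this says that replacing the entry at \<open>u\<close> by \<open>k\<close> keeps \<open>T\<close> semistandard
(\<open>is_ssyt_raise_iff\<close>). In this form the condition involves only the right and the lower neighbour,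
which makes its behaviour under branching visible.
\<close>

definition raisable :: "cell set \<Rightarrow> (cell \<Rightarrow> nat) \<Rightarrow> cell \<Rightarrow> nat \<Rightarrow> bool" where
  "raisable D T u k \<longleftrightarrow>
     ((fst u, Suc (snd u)) \<in> D \<longrightarrow> k \<le> T (fst u, Suc (snd u))) \<and>
     ((Suc (fst u), snd u) \<in> D \<longrightarrow> k < T (Suc (fst u), snd u))"

text \<open>
The summand of the theorem with the power of \<open>q\<close> distributed over the cells. The integers \<open>a k\<close> are
unrestricted; for a partition they are its parts in reverse order.
\<close>

definition tweight :: "'a::field \<Rightarrow> (nat \<Rightarrow> int) \<Rightarrow> nat \<Rightarrow> cell set \<Rightarrow> (cell \<Rightarrow> nat) \<Rightarrow> 'a" where
  "tweight q a d D T = (\<Prod>u\<in>D. (1 - q powi (a (T u) - content u)) *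
     (\<Prod>k | T u < k \<and> k \<le> d \<and> raisable D T u k. q powi (a k - content u)))"

definition tabsum :: "'a::field \<Rightarrow> (nat \<Rightarrow> int) \<Rightarrow> nat \<Rightarrow> (nat \<Rightarrow> nat) \<Rightarrow> 'a" where
  "tabsum q a d m = (\<Sum>T\<in>tabs d (cells m). tweight q a d (cells m) T)"

lemma finite_tabs: "finite D \<Longrightarrow> finite (tabs d D)"
  by (rule finite_subset[OF _ finite_PiE[of D "\<lambda>_. {1..d}"]]) (auto simp: tabs_def)

definition interlaced :: "nat \<Rightarrow> (nat \<Rightarrow> nat) \<Rightarrow> (nat \<Rightarrow> nat) set" where
  "interlaced d m = {k \<in> shapes d. (\<forall>i. k i \<le> m i) \<and> (\<forall>i\<ge>1. m (Suc i) \<le> k i)}"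

lemma finite_interlaced: "m \<in> shapes d' \<Longrightarrow> finite (interlaced d m)"
  by (rule finite_subset[OF _ finite_bounded_shapes[of d "m 1"]])
    (auto simp: interlaced_def intro: order_trans[OF _ shapes_le_first, simplified])

text \<open>
Taken from row \<open>1\<close>, this bounds the entries of row \<open>d + 1\<close> below by \<open>d + 1\<close>; read upwards it bounds the
entries of the first row above.
\<close>

lemma tabs_column:
  assumes m: "m \<in> shapes d'" and T: "T \<in> tabs d (cells m)" and i: "1 \<le> i"
    and c: "(i + r, j) \<in> cells m"
  shows "T (i, j) + r \<le> T (i + r, j)"
  using c
proof (induction r)
  case (Suc r)
  have "m (i + Suc r) \<le> m (i + r)" by (rule shapes_antimono[OF m]) (use i in auto)
  then have c: "(i + r, j) \<in> cells m" using Suc.prems by (auto simp: cells_def)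
  moreover have "T (i + r, j) < T (i + Suc r, j)"
    using T c Suc.prems unfolding tabs_def by (metis (no_types, lifting) mem_Collect_eq add_Suc_right lessI)
  ultimately show ?case using Suc.IH by simp
qed simp

lemma initial_segment_card:
  fixes A :: "nat set"
  assumes "finite A" "0 \<notin> A" and down: "\<And>j j'. j \<in> A \<Longrightarrow> 1 \<le> j' \<Longrightarrow> j' \<le> j \<Longrightarrow> j' \<in> A"
  shows "A = {1..card A}"
proof (cases "A = {}")
  case False
  have "A = {1..Max A}"
  proof (intro equalityI subsetI)
    fix j assume "j \<in> A"
    with assms show "j \<in> {1..Max A}" by (cases j) auto
  next
    fix j assume "j \<in> {1..Max A}"
    with down[OF Max_in[OF assms(1) False]] show "j \<in> A" by auto
  qed
  then show ?thesis by (metis card_atLeastAtMost diff_Suc_1)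
qed simp

text \<open>
The shape of the cells with entry at most \<open>d\<close>. Rows increase weakly, so counting these cells in each
row determines the set.
\<close>

definition lower_shape :: "nat \<Rightarrow> (nat \<Rightarrow> nat) \<Rightarrow> (cell \<Rightarrow> nat) \<Rightarrow> nat \<Rightarrow> nat" where
  "lower_shape d m T i = card {j \<in> {1..m i}. T (i, j) \<le> d}"

definition extend :: "nat \<Rightarrow> (nat \<Rightarrow> nat) \<Rightarrow> (nat \<Rightarrow> nat) \<Rightarrow> (cell \<Rightarrow> nat) \<Rightarrow> cell \<Rightarrow> nat" where
  "extend d m k T = (\<lambda>u. if u \<in> cells k then T u else if u \<in> cells m then Suc d else undefined)"

lemma tabs_row: "T \<in> tabs d D \<Longrightarrow> (i, j) \<in> D \<Longrightarrow> (i, j') \<in> D \<Longrightarrow> j \<le> j' \<Longrightarrow> T (i, j) \<le> T (i, j')"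
  unfolding tabs_def by (cases "j = j'") auto

lemma tabs_col: "T \<in> tabs d D \<Longrightarrow> (i, j) \<in> D \<Longrightarrow> (i', j) \<in> D \<Longrightarrow> i < i' \<Longrightarrow> T (i, j) < T (i', j)"
  unfolding tabs_def by auto

lemma tabs_range: "T \<in> tabs d D \<Longrightarrow> u \<in> D \<Longrightarrow> 1 \<le> T u \<and> T u \<le> d"
  unfolding tabs_def by (auto dest: PiE_mem)

lemma lower_shape_row:
  assumes T: "T \<in> tabs (Suc d) (cells m)"
  shows "{j \<in> {1..m i}. T (i, j) \<le> d} = {1..lower_shape d m T i}"
  unfolding lower_shape_def
proof (rule initial_segment_card)
  fix j j' assume a: "j \<in> {j \<in> {1..m i}. T (i, j) \<le> d}" "1 \<le> j'" "j' \<le> j"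
  then have "T (i, j') \<le> T (i, j)" by (intro tabs_row[OF T]) (auto simp: cells_def)
  with a show "j' \<in> {j \<in> {1..m i}. T (i, j) \<le> d}" by auto
qed auto

lemma cells_lower_shape:
  assumes T: "T \<in> tabs (Suc d) (cells m)"
  shows "cells (lower_shape d m T) = {u \<in> cells m. T u \<le> d}"
proof -
  have "(1 \<le> j \<and> j \<le> lower_shape d m T i) \<longleftrightarrow> (1 \<le> j \<and> j \<le> m i) \<and> T (i, j) \<le> d" for i j
    using lower_shape_row[OF T, of i] by (auto simp: set_eq_iff)
  then show ?thesis by (auto simp: cells_def)
qed

text \<open>
An entry of row \<open>i + 1\<close> exceeds the entry above it, which is therefore at most \<open>d\<close>: the cells with entry
\<open>d + 1\<close> form a horizontal strip. Row \<open>d + 1\<close> consists of entries \<open>d + 1\<close> only, so the lower shape has at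
most \<open>d\<close> rows.
\<close>

lemma lower_shape_interlaced:
  assumes m: "m \<in> shapes (Suc d)" and T: "T \<in> tabs (Suc d) (cells m)"
  shows "lower_shape d m T \<in> interlaced d m"
proof -
  note row = lower_shape_row[OF T]
  have le: "lower_shape d m T i \<le> m i" for i
    using card_mono[of "{1..m i}" "{j \<in> {1..m i}. T (i, j) \<le> d}"] unfolding lower_shape_def
    by (metis (no_types, lifting) card_atLeastAtMost diff_Suc_1 finite_atLeastAtMost mem_Collect_eq subsetI)
  have step: "m (Suc i) \<le> lower_shape d m T i" if i: "1 \<le> i" for i
  proof (cases "m (Suc i) = 0")
    case False
    have c: "(Suc i, m (Suc i)) \<in> cells m" "(i, m (Suc i)) \<in> cells m"
      using False shapes_antimono[OF m i, of "Suc i"] by (auto simp: cells_def)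
    have "T (i, m (Suc i)) \<le> d"
      using tabs_col[OF T c(2,1)] tabs_range[OF T c(1)] by simp
    then have "m (Suc i) \<in> {1..lower_shape d m T i}"
      unfolding row[symmetric] using c(2) by (auto simp: cells_def)
    then show ?thesis by simp
  qed simp
  have z: "lower_shape d m T i = 0" if "i > d" for i
  proof (cases "i = Suc d")
    case True
    have "\<not> T (Suc d, j) \<le> d" if "(Suc d, j) \<in> cells m" for j
    proof -
      have "(1, j) \<in> cells m" using that shapes_antimono[OF m, of 1 "Suc d"] by (auto simp: cells_def)
      then show ?thesis using tabs_column[OF m T, of 1 d j] that tabs_range[OF T, of "(1, j)"] by simp
    qed
    then show ?thesis using True by (auto simp: lower_shape_def cells_def)
  next
    case False
    with that m have "m i = 0" by (auto simp: shapes_def)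
    with le[of i] show ?thesis by simp
  qed
  have "lower_shape d m T (Suc i) \<le> lower_shape d m T i" if "1 \<le> i" for i
    using le[of "Suc i"] step[OF that] by simp
  moreover have "lower_shape d m T 0 = 0" using le[of 0] m by (simp add: shapes_def)
  ultimately show ?thesis using le step z by (simp add: interlaced_def shapes_def)
qed

lemma restrict_tabs:
  assumes "T \<in> tabs (Suc d) (cells m)"
  shows "restrict T (cells (lower_shape d m T)) \<in> tabs d (cells (lower_shape d m T))"
  unfolding cells_lower_shape[OF assms] using assms unfolding tabs_def by (auto dest: PiE_mem)

lemma extend_restrict:
  assumes "T \<in> tabs (Suc d) (cells m)"
  shows "extend d m (lower_shape d m T) (restrict T (cells (lower_shape d m T))) = T"
proof
  fix u
  have "T u = Suc d" if "u \<in> cells m" "\<not> T u \<le> d" using tabs_range[OF assms that(1)] that(2) by simp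
  moreover have "T u = undefined" if "u \<notin> cells m"
    using assms that unfolding tabs_def by (auto intro: PiE_arb)
  ultimately show "extend d m (lower_shape d m T) (restrict T (cells (lower_shape d m T))) u = T u"
    unfolding extend_def cells_lower_shape[OF assms] by auto
qed

lemma interlaced_cells: "k \<in> interlaced d m \<Longrightarrow> cells k \<subseteq> cells m"
  by (auto simp: interlaced_def cells_def intro: order_trans)

text \<open>
Interlacing puts every cell that has a cell of the outer shape below it into the inner shape, so two
entries \<open>d + 1\<close> never meet in a column.
\<close>

lemma extend_tabs:
  assumes m: "m \<in> shapes (Suc d)" and k: "k \<in> interlaced d m" and T: "T \<in> tabs d (cells k)"
  shows "extend d m k T \<in> tabs (Suc d) (cells m)"
proof -
  note sub = interlaced_cells[OF k]
  have r: "1 \<le> T u \<and> T u \<le> d" if "u \<in> cells k" for u using tabs_range[OF T that] .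
  have "extend d m k T \<in> cells m \<rightarrow>\<^sub>E {1..Suc d}"
  proof (rule PiE_I)
    fix u assume "u \<in> cells m"
    then show "extend d m k T u \<in> {1..Suc d}" using r[of u] by (auto simp: extend_def)
  qed (use sub in \<open>auto simp: extend_def\<close>)
  moreover have "extend d m k T (i, j) \<le> extend d m k T (i, j')"
    if "(i, j) \<in> cells m" "(i, j') \<in> cells m" "j < j'" for i j j'
  proof (cases "(i, j') \<in> cells k")
    case True
    then have c: "(i, j) \<in> cells k" using that by (auto simp: cells_def)
    then show ?thesis using True tabs_row[OF T c True] that by (simp add: extend_def)
  next
    case False
    then show ?thesis using that r[of "(i, j)"] by (auto simp: extend_def)
  qed
  moreover have "extend d m k T (i, j) < extend d m k T (i', j)"
    if a: "(i, j) \<in> cells m" "(i', j) \<in> cells m" "i < i'" for i i' j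
  proof -
    have i: "1 \<le> i" using a m by (cases i) (auto simp: cells_def shapes_def)
    have "m i' \<le> m (Suc i)" using shapes_antimono[OF m, of "Suc i" i'] a by simp
    then have "j \<le> k i" using k i a by (fastforce simp: interlaced_def cells_def)
    then have c: "(i, j) \<in> cells k" using a by (auto simp: cells_def)
    show ?thesis
    proof (cases "(i', j) \<in> cells k")
      case True
      with c tabs_col[OF T c True a(3)] show ?thesis by (simp add: extend_def)
    next
      case False
      with c a r[OF c] show ?thesis by (simp add: extend_def)
    qed
  qed
  ultimately show ?thesis by (auto simp: tabs_def)
qed

lemma lower_shape_extend:
  assumes m: "m \<in> shapes (Suc d)" and k: "k \<in> interlaced d m" and T: "T \<in> tabs d (cells k)"
  shows "lower_shape d m (extend d m k T) = k"
proof
  fix i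
  have "{j \<in> {1..m i}. extend d m k T (i, j) \<le> d} = {1..k i}"
    using tabs_range[OF T] k
    by (auto simp: extend_def cells_def interlaced_def intro: order_trans split: if_splits)
  then show "lower_shape d m (extend d m k T) i = k i" by (simp add: lower_shape_def)
qed

lemma restrict_extend:
  assumes T: "T \<in> tabs d (cells k)"
  shows "restrict (extend d m k T) (cells k) = T"
  using assms by (auto simp: tabs_def extend_def PiE_def extensional_def restrict_def)

lemma raisable_extend:
  assumes m: "m \<in> shapes (Suc d)" and k: "k \<in> interlaced d m" and T: "T \<in> tabs d (cells k)"
    and u: "u \<in> cells k" and l: "l \<le> d"
  shows "raisable (cells m) (extend d m k T) u l \<longleftrightarrow> raisable (cells k) T u l"
proof -
  have "v \<in> cells m" if "v \<in> cells k" for v using interlaced_cells[OF k] that by blast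
  then show ?thesis using l by (auto simp: raisable_def extend_def)
qed

text \<open>
Raising to the largest entry is blocked by every right neighbour in the inner shape and by every
lower neighbour in the outer shape; only the last cell of an inner row with nothing below it
remains.
\<close>

lemma raisable_top:
  assumes m: "m \<in> shapes (Suc d)" and k: "k \<in> interlaced d m" and T: "T \<in> tabs d (cells k)"
    and u: "(i, j) \<in> cells k"
  shows "raisable (cells m) (extend d m k T) (i, j) (Suc d) \<longleftrightarrow> j = k i \<and> m (Suc i) < k i"
proof
  assume R: "raisable (cells m) (extend d m k T) (i, j) (Suc d)"
  have j: "1 \<le> j" "j \<le> k i" using u by (auto simp: cells_def)
  have "\<not> j < k i"
  proof
    assume "j < k i"
    then have c: "(i, Suc j) \<in> cells k" by (auto simp: cells_def)
    with interlaced_cells[OF k] R have "Suc d \<le> T (i, Suc j)"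
      by (auto simp: raisable_def extend_def)
    with tabs_range[OF T c] show False by simp
  qed
  moreover have "\<not> j \<le> m (Suc i)"
  proof
    assume "j \<le> m (Suc i)"
    with j have "(Suc i, j) \<in> cells m" by (auto simp: cells_def)
    with R have "Suc d < extend d m k T (Suc i, j)" by (simp add: raisable_def)
    moreover have "extend d m k T (Suc i, j) \<le> Suc d"
      using tabs_range[OF extend_tabs[OF m k T]] \<open>(Suc i, j) \<in> cells m\<close> by blast
    ultimately show False by simp
  qed
  ultimately show "j = k i \<and> m (Suc i) < k i" using j by auto
next
  assume "j = k i \<and> m (Suc i) < k i"
  then show "raisable (cells m) (extend d m k T) (i, j) (Suc d)"
    by (auto simp: raisable_def extend_def cells_def)
qed

text \<open>
Cells with entry \<open>d + 1\<close> cannot be raised within the bound and contribute the strip factors. The other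
cells keep the weight that they have in the restricted tableau, up to the extra candidate \<open>d + 1\<close>,
which contributes the corner factors.
\<close>

lemma tweight_extend:
  fixes q :: "'a::field"
  assumes q: "q \<noteq> 0" and m: "m \<in> shapes (Suc d)" and k: "k \<in> interlaced d m" and T: "T \<in> tabs d (cells k)"
  shows "tweight q a (Suc d) (cells m) (extend d m k T) =
    branch q (q powi a (Suc d)) d m k * tweight q a d (cells k) T"
proof -
  let ?T = "extend d m k T" and ?x = "q powi a (Suc d)"
  define f where "f u = (1 - q powi (a (?T u) - content u)) *
     (\<Prod>l | ?T u < l \<and> l \<le> Suc d \<and> raisable (cells m) ?T u l. q powi (a l - content u))" for u
  define g where "g u = (1 - q powi (a (T u) - content u)) *
     (\<Prod>l | T u < l \<and> l \<le> d \<and> raisable (cells k) T u l. q powi (a l - content u))" for u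
  have ks: "k \<in> shapes d" using k by (simp add: interlaced_def)
  have x: "?x * q powi (int i - int j) = q powi (a (Suc d) - content (i, j))" for i j
  proof -
    have "a (Suc d) - content (i, j) = a (Suc d) + (int i - int j)" by (simp add: content_def)
    then show ?thesis by (simp only: power_int_add[OF disjI1[OF q]])
  qed
  have new: "f (i, j) = 1 - ?x * q powi (int i - int j)" if "(i, j) \<in> cells m - cells k" for i j
    using that unfolding x by (auto simp: f_def extend_def intro!: prod.neutral)
  have old: "f (i, j) = g (i, j) * (if j = k i then corner q ?x i (k i) (m (Suc i)) else 1)"
    if c: "(i, j) \<in> cells k" for i j
  proof -
    have Tu: "?T (i, j) = T (i, j)" using c by (simp add: extend_def)
    have le: "T (i, j) \<le> d" using tabs_range[OF T c] by simp
    have i: "1 \<le> i" using c ks by (cases i) (auto simp: cells_def shapes_def)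
    have "{l. T (i, j) < l \<and> l \<le> Suc d \<and> raisable (cells m) ?T (i, j) l} =
        {l. T (i, j) < l \<and> l \<le> d \<and> raisable (cells k) T (i, j) l} \<union>
        (if j = k i \<and> m (Suc i) < k i then {Suc d} else {})"
      using raisable_extend[OF m k T c] raisable_top[OF m k T c] le by (auto simp: le_Suc_eq)
    moreover have "m (Suc i) \<le> k i" using k i by (auto simp: interlaced_def)
    ultimately show ?thesis unfolding f_def g_def Tu
      by (auto simp: corner_def x prod.union_disjoint)
  qed
  have corners: "(\<Prod>(i, j)\<in>cells k. if j = k i then corner q ?x i (k i) (m (Suc i)) else 1) =
     (\<Prod>i=1..d. corner q ?x i (k i) (m (Suc i)))"
  proof -
    have "(\<Prod>(i, j)\<in>cells k. if j = k i then corner q ?x i (k i) (m (Suc i)) else 1) =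
       (\<Prod>i=1..d. \<Prod>j=1..k i. if j = k i then corner q ?x i (k i) (m (Suc i)) else 1)"
      unfolding cells_Sigma[OF ks] by (subst prod.Sigma) auto
    also have "\<dots> = (\<Prod>i=1..d. corner q ?x i (k i) (m (Suc i)))"
    proof (rule prod.cong[OF refl])
      fix i assume "i \<in> {1..d}"
      then have "m (Suc i) \<le> k i" using k by (auto simp: interlaced_def)
      then show "(\<Prod>j=1..k i. if j = k i then corner q ?x i (k i) (m (Suc i)) else 1) =
          corner q ?x i (k i) (m (Suc i))"
        by (cases "k i = 0") (simp_all add: prod.delta corner_def)
    qed
    finally show ?thesis .
  qed
  have diff: "cells m - cells k = Sigma {1..Suc d} (\<lambda>i. {k i<..m i})"
    unfolding cells_Sigma[OF m] by (auto simp: cells_def)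
  have strips: "(\<Prod>(i, j)\<in>cells m - cells k. 1 - ?x * q powi (int i - int j)) =
     (\<Prod>i=1..Suc d. strip q ?x i (k i) (m i))"
    unfolding diff using k by (subst prod.Sigma[symmetric]) (auto simp: strip_def interlaced_def)
  have "tweight q a (Suc d) (cells m) ?T = prod f (cells m - cells k) * prod f (cells k)"
    unfolding tweight_def f_def[symmetric]
    by (rule prod.subset_diff[OF interlaced_cells[OF k] finite_cells[OF m]])
  also have "prod f (cells m - cells k) = (\<Prod>i=1..Suc d. strip q ?x i (k i) (m i))"
    unfolding strips[symmetric] by (intro prod.cong) (auto simp: new simp del: of_nat_diff)
  also have "prod f (cells k) = (\<Prod>i=1..d. corner q ?x i (k i) (m (Suc i))) * prod g (cells k)"
    unfolding corners[symmetric] prod.distrib[symmetric] by (intro prod.cong) (auto simp: old)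
  finally show ?thesis unfolding branch_def tweight_def g_def by (simp only: mult_ac)
qed

lemma tabsum_branching:
  fixes q :: "'a::field"
  assumes q: "q \<noteq> 0" and m: "m \<in> shapes (Suc d)"
  shows "tabsum q a (Suc d) m =
    (\<Sum>k\<in>interlaced d m. branch q (q powi a (Suc d)) d m k * tabsum q a d k)"
proof -
  have fin: "\<forall>k\<in>interlaced d m. finite (tabs d (cells k))"
    by (auto simp: interlaced_def intro!: finite_tabs finite_cells)
  have "(\<Sum>k\<in>interlaced d m. branch q (q powi a (Suc d)) d m k * tabsum q a d k) =
     (\<Sum>(k, T)\<in>Sigma (interlaced d m) (\<lambda>k. tabs d (cells k)).
        branch q (q powi a (Suc d)) d m k * tweight q a d (cells k) T)"
    unfolding tabsum_def sum_distrib_left by (rule sum.Sigma[OF finite_interlaced[OF m] fin])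
  also have "\<dots> = tabsum q a (Suc d) m"
    unfolding tabsum_def
    by (rule sum.reindex_bij_witness[where
          i = "\<lambda>T. (lower_shape d m T, restrict T (cells (lower_shape d m T)))" and
          j = "\<lambda>(k, T). extend d m k T"])
      (auto simp: extend_restrict lower_shape_interlaced[OF m] restrict_tabs extend_tabs[OF m]
         lower_shape_extend[OF m] restrict_extend tweight_extend[OF q m])
  finally show ?thesis by simp
qed

lemma branch_eq_0:
  assumes m: "m \<in> shapes (Suc d)" and k: "k \<in> shapes d" and n: "k \<notin> interlaced d m"
  shows "branch q x d m k = 0"
proof -
  from n k consider i where "\<not> k i \<le> m i" | i where "1 \<le> i" "\<not> m (Suc i) \<le> k i"
    by (auto simp: interlaced_def)
  then show ?thesis
  proof cases
    case 1
    have "1 \<le> i" using 1 k by (cases i) (auto simp: shapes_def)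
    moreover have "\<not> i > d" using 1 k by (auto simp: shapes_def)
    ultimately have "i \<in> {1..Suc d}" by simp
    then have "(\<Prod>i=1..Suc d. strip q x i (k i) (m i)) = 0"
      using 1 by (intro prod_zero) (auto intro!: bexI[of _ i])
    then show ?thesis by (simp add: branch_def)
  next
    case 2
    have "\<not> Suc i > Suc d" using 2 m by (auto simp: shapes_def)
    then have "i \<in> {1..d}" using 2 by simp
    then have "(\<Prod>i=1..d. corner q x i (k i) (m (Suc i))) = 0"
      using 2 by (intro prod_zero) (auto simp: corner_def intro!: bexI[of _ i])
    then show ?thesis by (simp add: branch_def)
  qed
qed

section \<open>The Chevalley rule for tableau sums\<close>

text \<open>
After branching, \<open>kernel_commutation\<close> turns the alternating sum over the outer shape into one over
removals from the inner shape. Renaming the shrunk inner shape as the summation variable makes the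
alternating sum act on the tableau sum for \<open>d\<close>, where the induction hypothesis evaluates it.
\<close>

theorem tabsum_chevalley:
  fixes q :: "'a::field"
  assumes q: "q \<noteq> 0"
  shows "m \<in> shapes d \<Longrightarrow>
    (\<Sum>S\<in>Pow (add_rows d m). (-1) ^ card S * tabsum q a d (grow m S)) =
    q powi ((\<Sum>k=1..d. a k) - int (ncells d m)) * tabsum q a d m"
proof (induction d arbitrary: m)
  case 0
  have "add_rows 0 m = {}" "grow m {} = m" by (auto simp: add_rows_def grow_def)
  then show ?case by (simp add: ncells_def)
next
  case (Suc d)
  note m = Suc.prems
  define x where "x = q powi a (Suc d)"
  have x: "x \<noteq> 0" using q by (simp add: x_def)
  \<comment> \<open>A common finite range of inner shapes for \<open>m\<close> and for everything that grows from it; shapes that do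
    not interlace contribute \<open>0\<close>.\<close>
  define N where "N = Suc (m 1)"
  define K where "K = {k \<in> shapes d. \<forall>i. k i \<le> N}"
  have fK: "finite K" unfolding K_def by (rule finite_bounded_shapes)
  have KI: "K \<subseteq> shapes d" by (auto simp: K_def)
  have sum_K: "tabsum q a (Suc d) m' = (\<Sum>k\<in>K. branch q x d m' k * tabsum q a d k)"
    if m': "m' \<in> shapes (Suc d)" and le: "\<And>i. m' i \<le> N" for m'
    unfolding tabsum_branching[OF q m'] x_def
  proof (rule sum.mono_neutral_left[OF fK])
    show "interlaced d m' \<subseteq> K" using le by (auto simp: K_def interlaced_def intro: order_trans)
  qed (auto simp: K_def branch_eq_0[OF m'])
  have mN: "m i < N" for i using shapes_le_first[OF m, of i] by (simp add: N_def)
  define V where "V S k = (-1) ^ card S * (q powi (int (ncells d k) - int (card S)) *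
     (branch q x d m (shrink k S) * tabsum q a d k))" for S k
  have "(\<Sum>S\<in>Pow (add_rows (Suc d) m). (-1) ^ card S * tabsum q a (Suc d) (grow m S)) =
     (\<Sum>S\<in>Pow (add_rows (Suc d) m). \<Sum>k\<in>K.
        (-1) ^ card S * branch q x d (grow m S) k * tabsum q a d k)"
  proof (rule sum.cong[OF refl])
    fix S assume "S \<in> Pow (add_rows (Suc d) m)"
    then have "grow m S \<in> shapes (Suc d)" using m grow_shapes by blast
    moreover have "grow m S i \<le> N" for i using mN[of i] by (simp add: grow_def)
    ultimately show "(-1) ^ card S * tabsum q a (Suc d) (grow m S) =
       (\<Sum>k\<in>K. (-1) ^ card S * branch q x d (grow m S) k * tabsum q a d k)"
      by (simp add: sum_K sum_distrib_left mult_ac)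
  qed
  also have "\<dots> = (\<Sum>k\<in>K. (\<Sum>S\<in>Pow (add_rows (Suc d) m). (-1) ^ card S * branch q x d (grow m S) k) *
       tabsum q a d k)"
    by (subst sum.swap) (simp add: sum_distrib_right)
  also have "\<dots> = x * q powi (- int (ncells (Suc d) m)) * (\<Sum>k\<in>K. \<Sum>S\<in>Pow (rem_rows d k). V S k)"
  proof (subst sum_distrib_left, rule sum.cong[OF refl])
    fix k assume "k \<in> K"
    then have ks: "k \<in> shapes d" using KI by auto
    show "(\<Sum>S\<in>Pow (add_rows (Suc d) m). (-1) ^ card S * branch q x d (grow m S) k) * tabsum q a d k =
       x * q powi (- int (ncells (Suc d) m)) * (\<Sum>S\<in>Pow (rem_rows d k). V S k)"
      unfolding kernel_commutation[OF q x m ks] V_def mult.assoc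
      by (simp only: sum_distrib_right mult.assoc)
  qed
  also have "(\<Sum>k\<in>K. \<Sum>S\<in>Pow (rem_rows d k). V S k) =
      (\<Sum>(k, S)\<in>Sigma K (\<lambda>k. Pow (rem_rows d k)). V S k)"
    by (rule sum.Sigma) (auto simp: fK rem_rows_def)
  also have "\<dots> = (\<Sum>(k, S)\<in>Sigma K (\<lambda>k. Pow (add_rows d k)).
      (-1) ^ card S * (q powi int (ncells d k) * (branch q x d m k * tabsum q a d (grow k S))))"
  \<comment> \<open>The correspondence between removals and additions leaves the finite range only where the kernel is
    \<open>0\<close>, so those pairs are excluded on both sides.\<close>
  proof (rule sum.reindex_bij_witness_not_neutral[where
        i = "\<lambda>(k, S). (grow k S, S)" and j = "\<lambda>(k, S). (shrink k S, S)" and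
        S' = "{(k, S) \<in> Sigma K (\<lambda>k. Pow (rem_rows d k)). shrink k S \<notin> interlaced d m}" and
        T' = "{(k, S) \<in> Sigma K (\<lambda>k. Pow (add_rows d k)). k \<notin> interlaced d m}"])
    show "finite {(k, S) \<in> Sigma K (\<lambda>k. Pow (rem_rows d k)). shrink k S \<notin> interlaced d m}"
      by (rule finite_subset[of _ "Sigma K (\<lambda>k. Pow (rem_rows d k))"])
        (auto intro!: finite_SigmaI fK simp: rem_rows_def)
    show "finite {(k, S) \<in> Sigma K (\<lambda>k. Pow (add_rows d k)). k \<notin> interlaced d m}"
      by (rule finite_subset[of _ "Sigma K (\<lambda>k. Pow (add_rows d k))"])
        (auto intro!: finite_SigmaI fK simp: add_rows_def)
  next
    fix p assume "p \<in> Sigma K (\<lambda>k. Pow (rem_rows d k)) -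
       {(k, S) \<in> Sigma K (\<lambda>k. Pow (rem_rows d k)). shrink k S \<notin> interlaced d m}"
    then obtain k S where p: "p = (k, S)" "k \<in> K" "S \<subseteq> rem_rows d k" "shrink k S \<in> interlaced d m"
      by (cases p) auto
    then have ks: "k \<in> shapes d" using KI by auto
    show "(case (case p of (k, S) \<Rightarrow> (shrink k S, S)) of (k, S) \<Rightarrow> (grow k S, S)) = p"
      using p grow_shrink by auto
    have "shrink k S \<in> K" using p(2) shrink_shapes[OF ks p(3)]
      by (auto simp: K_def shrink_def intro: order_trans[OF diff_le_self])
    then show "(case p of (k, S) \<Rightarrow> (shrink k S, S)) \<in> Sigma K (\<lambda>k. Pow (add_rows d k)) -
       {(k, S) \<in> Sigma K (\<lambda>k. Pow (add_rows d k)). k \<notin> interlaced d m}"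
      using p shrink_addable[OF ks p(3)] by auto
  next
    fix p assume "p \<in> Sigma K (\<lambda>k. Pow (add_rows d k)) -
       {(k, S) \<in> Sigma K (\<lambda>k. Pow (add_rows d k)). k \<notin> interlaced d m}"
    then obtain k S where p: "p = (k, S)" "k \<in> K" "S \<subseteq> add_rows d k" "k \<in> interlaced d m"
      by (cases p) auto
    then have ks: "k \<in> shapes d" using KI by auto
    show "(case (case p of (k, S) \<Rightarrow> (grow k S, S)) of (k, S) \<Rightarrow> (shrink k S, S)) = p"
      using p shrink_grow by auto
    have "grow k S i \<le> N" for i
      using p(4) mN[of i] by (auto simp: grow_def interlaced_def Suc_le_eq intro: le_less_trans less_imp_le)
    then have "grow k S \<in> K" using grow_shapes[OF ks p(3)] by (simp add: K_def)
    then show "(case p of (k, S) \<Rightarrow> (grow k S, S)) \<in> Sigma K (\<lambda>k. Pow (rem_rows d k)) -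
       {(k, S) \<in> Sigma K (\<lambda>k. Pow (rem_rows d k)). shrink k S \<notin> interlaced d m}"
      using p grow_removable[OF ks p(3)] by (auto simp: shrink_grow)
  next
    fix p assume "p \<in> {(k, S) \<in> Sigma K (\<lambda>k. Pow (rem_rows d k)). shrink k S \<notin> interlaced d m}"
    then show "(case p of (k, S) \<Rightarrow> V S k) = 0"
      using KI by (auto simp: V_def branch_eq_0[OF m] shrink_shapes)
  next
    fix p assume "p \<in> {(k, S) \<in> Sigma K (\<lambda>k. Pow (add_rows d k)). k \<notin> interlaced d m}"
    then show "(case p of (k, S) \<Rightarrow> (-1) ^ card S *
       (q powi int (ncells d k) * (branch q x d m k * tabsum q a d (grow k S)))) = 0"
      using KI by (auto simp: branch_eq_0[OF m])
  next
    fix p assume "p \<in> Sigma K (\<lambda>k. Pow (rem_rows d k))"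
    then obtain k S where p: "p = (k, S)" "k \<in> K" "S \<subseteq> rem_rows d k" by (cases p) auto
    then have ks: "k \<in> shapes d" using KI by auto
    have "ncells d k = ncells d (shrink k S) + card S"
    proof -
      have "S \<subseteq> {1..d}" using p(3) by (auto simp: rem_rows_def)
      from ncells_grow[OF this, of "shrink k S"] show ?thesis by (simp add: grow_shrink[OF p(3)])
    qed
    then show "(case (case p of (k, S) \<Rightarrow> (shrink k S, S)) of (k, S) \<Rightarrow> (-1) ^ card S *
       (q powi int (ncells d k) * (branch q x d m k * tabsum q a d (grow k S)))) =
       (case p of (k, S) \<Rightarrow> V S k)"
      using p by (simp add: V_def grow_shrink)
  qed
  also have "\<dots> = (\<Sum>k\<in>K. \<Sum>S\<in>Pow (add_rows d k).
      (-1) ^ card S * (q powi int (ncells d k) * (branch q x d m k * tabsum q a d (grow k S))))"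
    by (rule sum.Sigma[symmetric]) (auto simp: fK add_rows_def)
  also have "\<dots> = (\<Sum>k\<in>K. q powi int (ncells d k) * branch q x d m k *
      (\<Sum>S\<in>Pow (add_rows d k). (-1) ^ card S * tabsum q a d (grow k S)))"
    by (simp add: sum_distrib_left mult_ac)
  also have "\<dots> = (\<Sum>k\<in>K. q powi (\<Sum>k=1..d. a k) * (branch q x d m k * tabsum q a d k))"
  proof (rule sum.cong[OF refl])
    fix k assume "k \<in> K"
    then have ks: "k \<in> shapes d" using KI by auto
    have e: "q powi (\<Sum>k=1..d. a k) =
        q powi int (ncells d k) * q powi ((\<Sum>k=1..d. a k) - int (ncells d k))"
      using q power_int_add[of q "int (ncells d k)" "(\<Sum>k=1..d. a k) - int (ncells d k)"] by simp
    show "q powi int (ncells d k) * branch q x d m k *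
      (\<Sum>S\<in>Pow (add_rows d k). (-1) ^ card S * tabsum q a d (grow k S)) =
      q powi (\<Sum>k=1..d. a k) * (branch q x d m k * tabsum q a d k)"
      unfolding Suc.IH[OF ks] e by (simp only: mult_ac)
  qed
  also have "\<dots> = q powi (\<Sum>k=1..d. a k) * tabsum q a (Suc d) m"
    using mN by (simp add: sum_K[OF m] less_imp_le sum_distrib_left)
  also have "x * q powi (- int (ncells (Suc d) m)) * \<dots> =
      q powi ((\<Sum>k=1..Suc d. a k) - int (ncells (Suc d) m)) * tabsum q a (Suc d) m"
  proof -
    have e: "(\<Sum>k=1..Suc d. a k) - int (ncells (Suc d) m) =
        a (Suc d) + (- int (ncells (Suc d) m)) + (\<Sum>k=1..d. a k)" by simp
    show ?thesis unfolding e x_def by (simp only: power_int_add[OF disjI1[OF q]] mult.assoc)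
  qed
  finally show ?case .
qed

section \<open>Vanishing and normalization\<close>

text \<open>
Follow the weights \<open>L (r j) - (j - 1)\<close> of the cells of the first row, where \<open>r j = d + 1 - T (1, j)\<close>. The
first one is positive. Since \<open>r\<close> decreases weakly, \<open>L (r j)\<close> increases weakly, and a weight is smaller
than its predecessor by at most \<open>1\<close>. If row \<open>i\<close> is too long, its last column has \<open>i\<close> strictly increasing
entries, so \<open>r \<ge> i\<close> there and the weight is at most \<open>0\<close>. Hence some weight is \<open>0\<close>, and its factor
kills the tableau.
\<close>

lemma tabsum_vanishes:
  fixes q :: "'a::field"
  assumes L: "L \<in> shapes d" and pos: "\<And>i. 1 \<le> i \<Longrightarrow> i \<le> d \<Longrightarrow> 0 < L i"
    and m: "m \<in> shapes d" and i: "L i < m i"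
  shows "tabsum q (\<lambda>k. int (L (Suc d - k))) d m = 0"
  unfolding tabsum_def
proof (rule sum.neutral, rule ballI)
  fix T assume T: "T \<in> tabs d (cells m)"
  have i1: "1 \<le> i" "i \<le> d" using i m by (auto simp: shapes_def not_less_eq_eq Suc_le_eq intro!: gr0I)
    (metis not_less not_less0)
  have c1: "(1, j) \<in> cells m" if "1 \<le> j" "j \<le> m i" for j
    using that shapes_antimono[OF m order_refl i1(1)] by (auto simp: cells_def)
  define r where "r j = Suc d - T (1, j)" for j
  have r: "1 \<le> r j \<and> r j \<le> d" if "1 \<le> j" "j \<le> m i" for j
    using tabs_range[OF T c1[OF that]] by (auto simp: r_def)
  \<comment> \<open>The first column where the weight is no longer positive is the one where it is \<open>0\<close>.\<close>
  define P where "P j \<longleftrightarrow> 1 \<le> j \<and> L (r j) < j" for j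
  have mi: "1 \<le> m i" using i by simp
  have "T (1, m i) + (i - 1) \<le> T (1 + (i - 1), m i)"
    by (rule tabs_column[OF m T]) (use i1 mi in \<open>auto simp: cells_def\<close>)
  moreover have "T (i, m i) \<le> d" using tabs_range[OF T, of "(i, m i)"] mi by (auto simp: cells_def)
  ultimately have "i \<le> r (m i)" using i1 by (simp add: r_def)
  then have "L (r (m i)) \<le> L i" using shapes_antimono[OF L i1(1)] by simp
  then have Pm: "P (m i)" using i mi by (simp add: P_def)
  define j where "j = (LEAST j. P j)"
  have Pj: "P j" unfolding j_def using Pm by (rule LeastI)
  have jm: "j \<le> m i" unfolding j_def using Pm by (rule Least_le)
  have j1: "1 \<le> j" using Pj by (simp add: P_def)
  have "j \<noteq> 1" using Pj pos[of "r j"] r[OF j1 jm] by (auto simp: P_def)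
  with j1 have j2: "1 \<le> j - 1" by simp
  have "\<not> P (j - 1)" unfolding j_def[symmetric] using not_less_Least[of "j - 1" P] j1 by (simp add: j_def)
  then have "j - 1 \<le> L (r (j - 1))" using j2 by (simp add: P_def)
  also have "r j \<le> r (j - 1)"
    using tabs_row[OF T c1[OF j2] c1[OF j1 jm]] jm unfolding r_def by (intro diff_le_mono2) simp
  then have "L (r (j - 1)) \<le> L (r j)"
    using shapes_antimono[OF L, of "r j" "r (j - 1)"] r[OF j1 jm] by simp
  finally have "L (r j) = j - 1" using Pj by (auto simp: P_def)
  then have "int (L (Suc d - T (1, j))) - content (1, j) = 0"
    using j1 by (simp add: content_def r_def)
  moreover have "(1, j) \<in> cells m" by (rule c1[OF j1 jm])
  ultimately show "tweight q (\<lambda>k. int (L (Suc d - k))) d (cells m) T = 0"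
    unfolding tweight_def using finite_cells[OF m]
    by (intro prod_zero bexI[of _ "(1, j)"]) auto
qed

lemma tabsum_empty: "tabsum q a d (\<lambda>_. 0) = 1"
proof -
  have "cells (\<lambda>_. 0) = {}" by (auto simp: cells_def)
  moreover have "tabs d {} = {\<lambda>_. undefined}" by (auto simp: tabs_def)
  ultimately show ?thesis by (simp add: tabsum_def tweight_def)
qed

section \<open>Reverse plane partitions of skew shapes\<close>

lemma finite_RPP_weight:
  assumes "finite \<theta>" shows "finite {T \<in> RPP \<theta>. sum T \<theta> = n}"
proof (rule finite_subset)
  show "{T \<in> RPP \<theta>. sum T \<theta> = n} \<subseteq> \<theta> \<rightarrow>\<^sub>E {..n}"
  proof clarify
    fix T assume T: "T \<in> RPP \<theta>"
    have "T u \<le> sum T \<theta>" if "u \<in> \<theta>" for u using that assms by (intro member_le_sum) auto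
    with T show "T \<in> \<theta> \<rightarrow>\<^sub>E {..sum T \<theta>}" by (intro PiE_I) (auto simp: RPP_def intro: PiE_arb)
  qed
qed (simp add: finite_PiE assms)

text \<open>
The hypotheses say that the cells of \<open>S\<close> are minimal in their rows and columns, so zeros there put no
condition on the other entries.
\<close>

lemma card_RPP_zero_corners:
  assumes fin: "finite \<theta>" and S: "S \<subseteq> \<theta>"
    and row: "\<And>i j j'. (i, j) \<in> S \<Longrightarrow> (i, j') \<in> \<theta> \<Longrightarrow> j \<le> j'"
    and col: "\<And>i i' j. (i, j) \<in> S \<Longrightarrow> (i', j) \<in> \<theta> \<Longrightarrow> i \<le> i'"
  shows "card {T \<in> RPP (\<theta> - S). sum T (\<theta> - S) = n} = card {T \<in> RPP \<theta>. sum T \<theta> = n \<and> (\<forall>c\<in>S. T c = 0)}"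
proof (rule bij_betw_same_card)
  have sum0: "sum T \<theta> = sum T (\<theta> - S)" if "\<forall>c\<in>S. T c = 0" for T :: "cell \<Rightarrow> nat"
    using sum.subset_diff[OF S fin, of T] that by simp
  show "bij_betw (\<lambda>T u. if u \<in> S then 0 else T u) {T \<in> RPP (\<theta> - S). sum T (\<theta> - S) = n}
      {T \<in> RPP \<theta>. sum T \<theta> = n \<and> (\<forall>c\<in>S. T c = 0)}"
  proof (rule bij_betw_byWitness[where f' = "\<lambda>T. restrict T (\<theta> - S)"])
    show "\<forall>T\<in>{T \<in> RPP (\<theta> - S). sum T (\<theta> - S) = n}.
        restrict (\<lambda>u. if u \<in> S then 0 else T u) (\<theta> - S) = T"
      by (fastforce simp: RPP_def PiE_def extensional_def restrict_def)
    show "\<forall>T\<in>{T \<in> RPP \<theta>. sum T \<theta> = n \<and> (\<forall>c\<in>S. T c = 0)}.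
        (\<lambda>u. if u \<in> S then 0 else restrict T (\<theta> - S) u) = T"
      using S by (fastforce simp: RPP_def PiE_def extensional_def restrict_def)
    show "(\<lambda>T u. if u \<in> S then 0 else T u) ` {T \<in> RPP (\<theta> - S). sum T (\<theta> - S) = n}
        \<subseteq> {T \<in> RPP \<theta>. sum T \<theta> = n \<and> (\<forall>c\<in>S. T c = 0)}"
    proof clarify
      fix T assume T: "T \<in> RPP (\<theta> - S)"
      let ?T = "\<lambda>u. if u \<in> S then 0 else T u"
      have "?T \<in> RPP \<theta>"
        using T S row col unfolding RPP_def
        by (auto simp: PiE_def extensional_def) (meson leD)+
      moreover have "sum ?T \<theta> = sum T (\<theta> - S)" by (subst sum0) (auto intro: sum.cong)
      ultimately show "?T \<in> RPP \<theta> \<and> sum ?T \<theta> = sum T (\<theta> - S) \<and> (\<forall>c\<in>S. ?T c = 0)" by simp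
    qed
    show "(\<lambda>T. restrict T (\<theta> - S)) ` {T \<in> RPP \<theta>. sum T \<theta> = n \<and> (\<forall>c\<in>S. T c = 0)}
        \<subseteq> {T \<in> RPP (\<theta> - S). sum T (\<theta> - S) = n}"
      using sum0 by (auto simp: RPP_def)
  qed
qed

lemma card_RPP_positive:
  assumes fin: "finite \<theta>"
  shows "card {T \<in> RPP \<theta>. sum T \<theta> = n \<and> (\<forall>u\<in>\<theta>. T u \<noteq> 0)} =
    (if n < card \<theta> then 0 else card {T \<in> RPP \<theta>. sum T \<theta> = n - card \<theta>})"
proof (cases "n < card \<theta>")
  case True
  have "card \<theta> \<le> sum T \<theta>" if "\<forall>u\<in>\<theta>. T u \<noteq> 0" for T :: "cell \<Rightarrow> nat"
    using sum_mono[of \<theta> "\<lambda>_. 1" T] that by (auto simp: Suc_le_eq)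
  with True have "{T \<in> RPP \<theta>. sum T \<theta> = n \<and> (\<forall>u\<in>\<theta>. T u \<noteq> 0)} = {}" by force
  with True show ?thesis by (simp only: card.empty if_True)
next
  case False
  have sum_Suc: "(\<Sum>u\<in>\<theta>. Suc (T u)) = sum T \<theta> + card \<theta>" for T by (simp add: sum_Suc)
  have "bij_betw (\<lambda>T. restrict (\<lambda>u. Suc (T u)) \<theta>) {T \<in> RPP \<theta>. sum T \<theta> = n - card \<theta>}
     {T \<in> RPP \<theta>. sum T \<theta> = n \<and> (\<forall>u\<in>\<theta>. T u \<noteq> 0)}"
  proof (rule bij_betw_byWitness[where f' = "\<lambda>T. restrict (\<lambda>u. T u - 1) \<theta>"])
    show "\<forall>T\<in>{T \<in> RPP \<theta>. sum T \<theta> = n - card \<theta>}.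
        restrict (\<lambda>u. restrict (\<lambda>u. Suc (T u)) \<theta> u - 1) \<theta> = T"
      by (fastforce simp: RPP_def PiE_def extensional_def restrict_def)
    show "\<forall>T\<in>{T \<in> RPP \<theta>. sum T \<theta> = n \<and> (\<forall>u\<in>\<theta>. T u \<noteq> 0)}.
        restrict (\<lambda>u. Suc (restrict (\<lambda>u. T u - 1) \<theta> u)) \<theta> = T"
      by (fastforce simp: RPP_def PiE_def extensional_def restrict_def)
    show "(\<lambda>T. restrict (\<lambda>u. Suc (T u)) \<theta>) ` {T \<in> RPP \<theta>. sum T \<theta> = n - card \<theta>}
        \<subseteq> {T \<in> RPP \<theta>. sum T \<theta> = n \<and> (\<forall>u\<in>\<theta>. T u \<noteq> 0)}"
      using False by (auto simp: RPP_def sum_Suc)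
    show "(\<lambda>T. restrict (\<lambda>u. T u - 1) \<theta>) ` {T \<in> RPP \<theta>. sum T \<theta> = n \<and> (\<forall>u\<in>\<theta>. T u \<noteq> 0)}
        \<subseteq> {T \<in> RPP \<theta>. sum T \<theta> = n - card \<theta>}"
    proof clarify
      fix T assume T: "T \<in> RPP \<theta>" "\<forall>u\<in>\<theta>. T u \<noteq> 0"
      have "sum T \<theta> = (\<Sum>u\<in>\<theta>. Suc (T u - 1))" using T(2) by (intro sum.cong) auto
      then have "(\<Sum>u\<in>\<theta>. T u - 1) = sum T \<theta> - card \<theta>" by (simp add: sum_Suc)
      with T show "restrict (\<lambda>u. T u - 1) \<theta> \<in> RPP \<theta> \<and>
          sum (restrict (\<lambda>u. T u - 1) \<theta>) \<theta> = sum T \<theta> - card \<theta>"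
        by (auto simp: RPP_def intro!: diff_le_mono)
    qed
  qed
  then show ?thesis using False by (simp add: bij_betw_same_card)
qed

text \<open>
\<open>C\<close> plays the role of the set of minimal cells: by \<open>dom\<close>, a reverse plane partition without zeros on
\<open>C\<close> has no zeros at all, and such fillings are counted by \<open>card_RPP_positive\<close>.
\<close>

lemma rpp_inclusion_exclusion:
  assumes fin: "finite \<theta>" and C: "C \<subseteq> \<theta>"
    and row: "\<And>i j j'. (i, j) \<in> C \<Longrightarrow> (i, j') \<in> \<theta> \<Longrightarrow> j \<le> j'"
    and col: "\<And>i i' j. (i, j) \<in> C \<Longrightarrow> (i', j) \<in> \<theta> \<Longrightarrow> i \<le> i'"
    and dom: "\<And>T u. T \<in> RPP \<theta> \<Longrightarrow> u \<in> \<theta> \<Longrightarrow> \<exists>c\<in>C. T c \<le> T u"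
  shows "(\<Sum>S\<in>Pow C. (-1) ^ card S * rpp (\<theta> - S)) = fps_X ^ card \<theta> * rpp \<theta>"
proof (rule fps_ext)
  fix n
  define A where "A = {T \<in> RPP \<theta>. sum T \<theta> = n}"
  have fA: "finite A" unfolding A_def by (rule finite_RPP_weight[OF fin])
  have fC: "finite C" using C fin finite_subset by blast
  \<comment> \<open>Being zero on \<open>S\<close> is a product of indicators; this makes the alternating sum over \<open>S\<close> a product
    over \<open>C\<close>.\<close>
  have card_sum: "(of_nat (card {T \<in> A. \<forall>c\<in>S. T c = 0}) :: rat) = (\<Sum>T\<in>A. \<Prod>c\<in>S. of_bool (T c = 0))"
    if "finite S" for S
  proof -
    have "(\<Prod>c\<in>S. of_bool (T c = 0)) = (of_bool (\<forall>c\<in>S. T c = 0) :: rat)"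
      for T :: "cell \<Rightarrow> nat"
      using that by (induction S) auto
    moreover have "{T \<in> A. \<forall>c\<in>S. T c = 0} = A \<inter> {T. \<forall>c\<in>S. T c = 0}" by auto
    ultimately show ?thesis using fA by simp
  qed
  have neg1: "(-1 :: rat fps) = fps_const (-1)" by (metis fps_const_1_eq_1 fps_const_neg)
  have pow: "(-1 :: rat fps) ^ k = fps_const ((-1) ^ k)" for k
    unfolding neg1 by (rule fps_const_power)
  have "(\<Sum>S\<in>Pow C. (-1) ^ card S * rpp (\<theta> - S)) $ n =
      (\<Sum>S\<in>Pow C. (-1) ^ card S * of_nat (card {T \<in> A. \<forall>c\<in>S. T c = 0}))"
    unfolding fps_sum_nth pow fps_mult_left_const_nth
  proof (intro sum.cong refl arg_cong2[where f = times])
    fix S assume "S \<in> Pow C"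
    then have S: "S \<subseteq> C" by simp
    have "rpp (\<theta> - S) $ n = of_nat (card {T \<in> RPP (\<theta> - S). sum T (\<theta> - S) = n})"
      by (simp add: rpp_def)
    also have "\<dots> = of_nat (card {T \<in> A. \<forall>c\<in>S. T c = 0})"
    proof -
      have "card {T \<in> RPP (\<theta> - S). sum T (\<theta> - S) = n} =
          card {T \<in> RPP \<theta>. sum T \<theta> = n \<and> (\<forall>c\<in>S. T c = 0)}"
        by (rule card_RPP_zero_corners[OF fin]) (use S C row col in blast)+
      then show ?thesis by (simp add: A_def conj_assoc)
    qed
    finally show "rpp (\<theta> - S) $ n = of_nat (card {T \<in> A. \<forall>c\<in>S. T c = 0})" .
  qed
  also have "\<dots> = (\<Sum>T\<in>A. \<Sum>S\<in>Pow C. (-1) ^ card S * (\<Prod>c\<in>S. of_bool (T c = 0)))"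
    using fC by (subst sum.swap) (auto simp: card_sum sum_distrib_left finite_subset intro!: sum.cong)
  also have "\<dots> = (\<Sum>T\<in>A. \<Prod>c\<in>C. 1 - of_bool (T c = 0))"
    by (simp add: prod_diff_conv_sum[OF fC])
  also have "\<dots> = (\<Sum>T\<in>A. of_bool (\<forall>u\<in>\<theta>. T u \<noteq> 0))"
  proof (rule sum.cong[OF refl])
    fix T assume "T \<in> A"
    then have "(\<forall>u\<in>\<theta>. T u \<noteq> 0) \<longleftrightarrow> (\<forall>c\<in>C. T c \<noteq> 0)"
      using dom[of T] C by (fastforce simp: A_def)
    moreover have "(\<Prod>c\<in>C. 1 - of_bool (T c = 0)) = (of_bool (\<forall>c\<in>C. T c \<noteq> 0) :: rat)"
      using fC by (induction C) auto
    ultimately show "(\<Prod>c\<in>C. 1 - of_bool (T c = 0)) = (of_bool (\<forall>u\<in>\<theta>. T u \<noteq> 0) :: rat)" by simp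
  qed
  also have "\<dots> = of_nat (card {T \<in> A. \<forall>u\<in>\<theta>. T u \<noteq> 0})"
    using fA by (simp add: Collect_conj_eq)
  also have "\<dots> = (fps_X ^ card \<theta> * rpp \<theta>) $ n"
    using card_RPP_positive[OF fin, of n]
    by (simp add: A_def rpp_def fps_X_power_mult_nth conj_ac)
  finally show "(\<Sum>S\<in>Pow C. (-1) ^ card S * rpp (\<theta> - S)) $ n = (fps_X ^ card \<theta> * rpp \<theta>) $ n" .
qed

text \<open>
Corners of \<open>m\<close> that do not fit into \<open>L\<close> carry the value \<open>0\<close>; the remaining ones are the minimal cells of
the skew shape. To reach the hypotheses of \<open>rpp_inclusion_exclusion\<close>, a corner whose entry is at most that
of a given cell \<open>(i, j)\<close> is found in the first row of \<open>m\<close> that is shorter than \<open>j\<close>.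
\<close>

lemma rpp_skew_recurrence:
  assumes m: "m \<in> shapes d" and L: "L \<in> shapes d" and le: "\<And>i. m i \<le> L i"
  shows "(\<Sum>S\<in>Pow (add_rows d m). (-1) ^ card S *
      (if \<forall>i. grow m S i \<le> L i then rpp (cells L - cells (grow m S)) else 0)) =
    fps_X ^ (ncells d L - ncells d m) * rpp (cells L - cells m)"
proof -
  define \<theta> where "\<theta> = cells L - cells m"
  define R where "R = {i \<in> add_rows d m. m i < L i}"
  define c where "c i = (i, Suc (m i))" for i
  define h where "h S = (if \<forall>i. grow m S i \<le> L i then rpp (cells L - cells (grow m S)) else 0)" for S
  have inj: "inj_on c A" for A by (auto simp: inj_on_def c_def)
  have fin: "finite \<theta>" unfolding \<theta>_def using finite_cells[OF L] by simp
  have sub: "cells m \<subseteq> cells L" using le by (auto simp: cells_def intro: order_trans)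
  have R1: "i = 1 \<or> m i < m (i - 1)" "1 \<le> i" "m i < L i" if "i \<in> R" for i
    using that by (auto simp: R_def add_rows_def)
  have C: "c ` R \<subseteq> \<theta>" using R1(3) by (auto simp: c_def \<theta>_def cells_def Suc_le_eq)
  have fits: "(\<forall>i. grow m S i \<le> L i) \<longleftrightarrow> S \<subseteq> R" if "S \<subseteq> add_rows d m" for S
  proof
    assume g: "\<forall>i. grow m S i \<le> L i"
    show "S \<subseteq> R"
    proof
      fix i assume "i \<in> S"
      with spec[OF g, of i] that show "i \<in> R" by (auto simp: grow_def R_def)
    qed
  next
    assume "S \<subseteq> R"
    then have "i \<in> S \<Longrightarrow> Suc (m i) \<le> L i" for i by (auto simp: R_def)
    then show "\<forall>i. grow m S i \<le> L i" using le by (simp add: grow_def)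
  qed
  have grown: "cells L - cells (grow m S) = \<theta> - c ` S" if "S \<subseteq> R" for S
    by (auto simp: \<theta>_def c_def cells_def grow_def image_iff le_Suc_eq of_bool_def split: if_splits)
  have "(\<Sum>S\<in>Pow (add_rows d m). (-1) ^ card S * h S) = (\<Sum>S\<in>Pow R. (-1) ^ card S * h S)"
  proof (rule sum.mono_neutral_right)
    show "finite (Pow (add_rows d m))" by (simp add: add_rows_def)
    show "Pow R \<subseteq> Pow (add_rows d m)" by (auto simp: R_def)
    show "\<forall>S\<in>Pow (add_rows d m) - Pow R. (-1) ^ card S * h S = 0"
      using fits by (simp add: h_def)
  qed
  also have "\<dots> = (\<Sum>S\<in>Pow R. (-1) ^ card (c ` S) * rpp (\<theta> - c ` S))"
  proof (rule sum.cong[OF refl])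
    fix S assume "S \<in> Pow R"
    then have S: "S \<subseteq> R" "S \<subseteq> add_rows d m" by (auto simp: R_def)
    then show "(-1) ^ card S * h S = (-1) ^ card (c ` S) * rpp (\<theta> - c ` S)"
      by (simp add: h_def fits grown card_image[OF inj])
  qed
  also have "\<dots> = (\<Sum>S\<in>Pow (c ` R). (-1) ^ card S * rpp (\<theta> - S))"
  proof -
    have "Pow (c ` R) = (`) c ` Pow R" by (simp add: image_Pow_surj)
    then show ?thesis by (simp add: sum.reindex[OF inj_on_image_Pow[OF inj]])
  qed
  also have "\<dots> = fps_X ^ card \<theta> * rpp \<theta>"
  proof (rule rpp_inclusion_exclusion[OF fin C])
    fix i j j' assume "(i, j) \<in> c ` R" "(i, j') \<in> \<theta>"
    then show "j \<le> j'" by (auto simp: c_def \<theta>_def cells_def)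
  next
    fix i i' j assume a: "(i, j) \<in> c ` R" "(i', j) \<in> \<theta>"
    then have i: "i \<in> R" and j: "j = Suc (m i)" by (auto simp: c_def)
    show "i \<le> i'"
    proof (rule ccontr)
      assume lt: "\<not> i \<le> i'"
      have "1 \<le> i'" using a(2) L by (cases i') (auto simp: \<theta>_def cells_def shapes_def)
      then have "m (i - 1) \<le> m i'" "i \<noteq> 1" using shapes_antimono[OF m, of i' "i - 1"] lt by auto
      then have "j \<le> m i'" using R1(1)[OF i] j by auto
      then show False using a(2) j by (auto simp: \<theta>_def cells_def)
    qed
  next
    fix T u assume T: "T \<in> RPP \<theta>" and u: "u \<in> \<theta>"
    obtain i j where ij: "u = (i, j)" by (cases u)
    have b: "1 \<le> j" "j \<le> L i" "m i < j" using u by (auto simp: ij \<theta>_def cells_def)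
    have i1: "1 \<le> i" using b L by (cases i) (auto simp: shapes_def)
    define k where "k = (LEAST k. 1 \<le> k \<and> m k < j)"
    have k: "1 \<le> k" "m k < j" using LeastI[of "\<lambda>k. 1 \<le> k \<and> m k < j" i] i1 b by (auto simp: k_def)
    have ki: "k \<le> i" unfolding k_def by (rule Least_le) (use i1 b in auto)
    have Lk: "j \<le> L k" using shapes_antimono[OF L k(1) ki] b by simp
    have kd: "k \<le> d" by (rule ccontr) (use L Lk b in \<open>simp add: shapes_def\<close>)
    have "j \<le> m (k - 1)" if "k \<noteq> 1"
      using not_less_Least[of "k - 1" "\<lambda>k. 1 \<le> k \<and> m k < j"] that k(1) unfolding k_def[symmetric] by auto
    then have kR: "k \<in> R" using k kd Lk by (fastforce simp: R_def add_rows_def)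
    have in\<theta>: "c k \<in> \<theta>" "(k, j) \<in> \<theta>" using C kR k b Lk by (auto simp: \<theta>_def cells_def)
    have "T (c k) \<le> T (k, j)"
      using T in\<theta> k(2) unfolding RPP_def c_def by (cases "Suc (m k) = j") auto
    also have "\<dots> \<le> T u"
      using T in\<theta>(2) u ki unfolding RPP_def ij by (cases "k = i") auto
    finally show "\<exists>x\<in>c ` R. T x \<le> T u" using kR by blast
  qed
  also have "card \<theta> = ncells d L - ncells d m"
    unfolding \<theta>_def by (simp add: card_Diff_subset[OF finite_cells[OF m] sub] card_cells[OF m] card_cells[OF L])
  finally show ?thesis by (simp add: h_def \<theta>_def)
qed

section \<open>Solutions of the recurrence\<close>

text \<open>
By induction on the number of missing cells, every term of the recurrence with \<open>S \<noteq> {}\<close> is \<open>0\<close>. What is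
left is \<open>D m = q ^ n * D m\<close> with \<open>n > 0\<close>.
\<close>

lemma recurrence_determines:
  fixes D :: "(nat \<Rightarrow> nat) \<Rightarrow> 'a::field"
  assumes q: "\<And>n. 0 < n \<Longrightarrow> q ^ n \<noteq> 1" and L: "L \<in> shapes d"
    and rec: "\<And>m. m \<in> shapes d \<Longrightarrow> \<forall>i. m i \<le> L i \<Longrightarrow>
      (\<Sum>S\<in>Pow (add_rows d m). (-1) ^ card S * D (grow m S)) = q ^ (ncells d L - ncells d m) * D m"
    and outside: "\<And>m. m \<in> shapes d \<Longrightarrow> \<not> (\<forall>i. m i \<le> L i) \<Longrightarrow> D m = 0"
    and top: "D L = 0"
  shows "m \<in> shapes d \<Longrightarrow> D m = 0"
proof (induction "ncells d L - ncells d m" arbitrary: m rule: less_induct)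
  case less
  note m = less.prems
  show ?case
  proof (cases "(\<forall>i. m i \<le> L i) \<and> m \<noteq> L")
    case True
    then have le: "\<forall>i. m i \<le> L i" by simp
    obtain i where "m i \<noteq> L i" using True by auto
    with le have i: "m i < L i" by (simp add: le_neq_implies_less)
    have "i \<noteq> 0" using i L by (intro notI) (simp add: shapes_def)
    moreover have "i \<le> d" by (rule ccontr) (use i L in \<open>simp add: shapes_def\<close>)
    ultimately have "i \<in> {1..d}" by simp
    then have size: "ncells d m < ncells d L"
      unfolding ncells_def using le i by (intro sum_strict_mono_ex1 bexI[of _ i]) simp_all
    have zero: "D (grow m S) = 0" if S: "S \<in> Pow (add_rows d m) - {{}}" for S
    proof -
      have gs: "grow m S \<in> shapes d" using grow_shapes[OF m] S by simp
      have "S \<subseteq> {1..d}" using S by (auto simp: add_rows_def)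
      moreover from this have "finite S" by (rule finite_subset) simp
      ultimately have "ncells d (grow m S) = ncells d m + card S" "0 < card S"
        using ncells_grow S by (auto simp: card_gt_0_iff)
      then show ?thesis using size by (intro less.hyps gs) simp
    qed
    have "finite (Pow (add_rows d m))" by (simp add: add_rows_def)
    then have "(\<Sum>S\<in>Pow (add_rows d m). (-1) ^ card S * D (grow m S)) = D (grow m {})"
      by (subst sum.remove[of _ "{}"]) (auto simp: zero)
    also have "grow m {} = m" by (simp add: grow_def)
    finally have "D m = q ^ (ncells d L - ncells d m) * D m" using rec[OF m le] by simp
    then show ?thesis using q[of "ncells d L - ncells d m"] size by auto
  qed (use outside[OF m] top in blast)
qed

text \<open>
The generating function of \<open>L/m\<close> and the tableau sum of \<open>m\<close> solve the same recurrence. The combination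
of the two that is \<open>0\<close> at \<open>L\<close> is therefore \<open>0\<close> everywhere; the empty shape gives the constant.
\<close>

lemma tabsum_eq_rpp_ratio:
  assumes L: "L \<in> shapes d" and pos: "\<And>i. 1 \<le> i \<Longrightarrow> i \<le> d \<Longrightarrow> 0 < L i"
    and m: "m \<in> shapes d" and le: "\<And>i. m i \<le> L i"
  shows "fps_to_fls (rpp (cells L - cells m)) / fps_to_fls (rpp (cells L)) =
    tabsum fls_X (\<lambda>k. int (L (Suc d - k))) d m"
proof -
  let ?F = "tabsum (fls_X :: rat fls) (\<lambda>k. int (L (Suc d - k))) d"
  define G :: "(nat \<Rightarrow> nat) \<Rightarrow> rat fls" where
    "G m = (if \<forall>i. m i \<le> L i then fps_to_fls (rpp (cells L - cells m)) else 0)" for m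
  have X: "(fls_X :: rat fls) ^ n \<noteq> 1" if "0 < n" for n
  proof
    assume "(fls_X :: rat fls) ^ n = 1"
    then have "fls_subdegree ((fls_X :: rat fls) ^ n) = 0" by simp
    with that show False by simp
  qed
  have G_rec: "(\<Sum>S\<in>Pow (add_rows d m). (-1) ^ card S * G (grow m S)) =
      fls_X ^ (ncells d L - ncells d m) * G m" if m: "m \<in> shapes d" and le: "\<forall>i. m i \<le> L i" for m
  proof -
    have eq: "(-1) ^ card S * G (grow m S) = fps_to_fls ((-1) ^ card S *
       (if \<forall>i. grow m S i \<le> L i then rpp (cells L - cells (grow m S)) else 0))" for S
      by (simp add: G_def fls_times_fps_to_fls fps_to_fls_power)
    have "(\<Sum>S\<in>Pow (add_rows d m). (-1) ^ card S * G (grow m S)) =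
       fps_to_fls (\<Sum>S\<in>Pow (add_rows d m). (-1) ^ card S *
       (if \<forall>i. grow m S i \<le> L i then rpp (cells L - cells (grow m S)) else 0))"
      unfolding eq by (rule sum_comp_morphism[unfolded o_def, of fps_to_fls]) simp_all
    also have "\<dots> = fps_to_fls (fps_X ^ (ncells d L - ncells d m) * rpp (cells L - cells m))"
      using le by (subst rpp_skew_recurrence[OF m L]) auto
    also have "\<dots> = fls_X ^ (ncells d L - ncells d m) * G m"
      using le by (simp add: G_def fls_times_fps_to_fls fps_to_fls_power)
    finally show ?thesis .
  qed
  have size: "(\<Sum>k=1..d. int (L (Suc d - k))) = int (ncells d L)"
    unfolding ncells_def using sum.atLeastAtMost_rev[of "\<lambda>k. int (L k)" 1 d] by simp
  \<comment> \<open>The exponent in the Chevalley rule is \<open>|L| - |m|\<close>, since the \<open>a k\<close> are the parts of \<open>L\<close>.\<close>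
  have F_rec: "(\<Sum>S\<in>Pow (add_rows d m). (-1) ^ card S * ?F (grow m S)) =
      fls_X ^ (ncells d L - ncells d m) * ?F m" if m: "m \<in> shapes d" and le: "\<forall>i. m i \<le> L i" for m
  proof -
    have "ncells d m \<le> ncells d L" using le by (auto simp: ncells_def intro: sum_mono)
    then have "(fls_X :: rat fls) powi (int (ncells d L) - int (ncells d m)) =
        fls_X ^ (ncells d L - ncells d m)"
      by (simp only: of_nat_diff[symmetric] power_int_of_nat)
    then show ?thesis using tabsum_chevalley[of "fls_X :: rat fls" m d "\<lambda>k. int (L (Suc d - k))"] m
      unfolding size by simp
  qed
  have proportional: "G m * ?F L - ?F m * G L = 0" if "m \<in> shapes d" for m
  proof (rule recurrence_determines[OF X L _ _ _ that])
    fix m assume a: "m \<in> shapes d" "\<forall>i. m i \<le> L i"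
    have "(\<Sum>S\<in>Pow (add_rows d m). (-1) ^ card S * (G (grow m S) * ?F L - ?F (grow m S) * G L)) =
      (\<Sum>S\<in>Pow (add_rows d m). (-1) ^ card S * G (grow m S)) * ?F L -
      (\<Sum>S\<in>Pow (add_rows d m). (-1) ^ card S * ?F (grow m S)) * G L"
      by (simp add: sum_distrib_right sum_subtractf right_diff_distrib mult.assoc)
    also have "\<dots> = fls_X ^ (ncells d L - ncells d m) * (G m * ?F L - ?F m * G L)"
      unfolding G_rec[OF a] F_rec[OF a] by (simp add: right_diff_distrib mult.assoc)
    finally show "(\<Sum>S\<in>Pow (add_rows d m). (-1) ^ card S * (G (grow m S) * ?F L - ?F (grow m S) * G L)) =
      fls_X ^ (ncells d L - ncells d m) * (G m * ?F L - ?F m * G L)" .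
  next
    fix m assume m: "m \<in> shapes d" and n: "\<not> (\<forall>i. m i \<le> L i)"
    then obtain i where i: "L i < m i" by (auto simp: not_le)
    have "?F m = 0" using tabsum_vanishes[OF L _ m i] pos by blast
    moreover have "G m = 0" using n unfolding G_def by (rule if_not_P)
    ultimately show "G m * ?F L - ?F m * G L = 0" by simp
  qed simp_all
  have "(\<lambda>_. 0) \<in> shapes d" by (simp add: shapes_def)
  moreover have "cells (\<lambda>_. 0) = {}" by (auto simp: cells_def)
  ultimately have one: "fps_to_fls (rpp (cells L)) * ?F L = G L"
    using proportional[of "\<lambda>_. 0"] by (simp add: tabsum_empty G_def)
  have GL: "G L = 1"
  proof -
    have "RPP {} = {\<lambda>_. undefined}" by (auto simp: RPP_def)
    then have "rpp {} = 1" by (auto simp: rpp_def fps_eq_iff)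
    then show ?thesis by (simp add: G_def)
  qed
  have "fps_to_fls (rpp (cells L)) \<noteq> 0" using one GL by force
  then have "?F L = 1 / fps_to_fls (rpp (cells L))" using one GL by (simp add: field_simps)
  with proportional[OF m] GL le show ?thesis by (simp add: G_def)
qed

section \<open>Partitions as lists and semistandard tableaux\<close>

lemma diagram_eq_cells: "diagram lam = cells (part lam)"
  by (auto simp: diagram_def cells_def part_def split: if_splits)

lemma part_in_shapes:
  assumes "is_partition lam" and "length lam \<le> d"
  shows "part lam \<in> shapes d"
proof -
  have "part lam (Suc i) \<le> part lam i" if "1 \<le> i" for i
    using assms that sorted_wrt_nth_less[of "(\<ge>)" lam "i - 1" i]
    by (auto simp: is_partition_def part_def)
  then show ?thesis using assms(2) by (auto simp: shapes_def part_def)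
qed

lemma part_pos: "is_partition lam \<Longrightarrow> 1 \<le> i \<Longrightarrow> i \<le> length lam \<Longrightarrow> 0 < part lam i"
  by (simp add: is_partition_def part_def)

lemma SSYT_eq_tabs: "SSYT \<mu> d = tabs d (diagram \<mu>)"
proof -
  have "T \<in> diagram \<mu> \<rightarrow>\<^sub>E {0<..} \<and> (\<forall>u\<in>diagram \<mu>. T u \<le> d) \<longleftrightarrow> T \<in> diagram \<mu> \<rightarrow>\<^sub>E {1..d}" for T
    by (auto simp: PiE_iff Suc_le_eq)
  then show ?thesis unfolding SSYT_def is_ssyt_def tabs_def
    by (intro Collect_cong) meson
qed

text \<open>
Raising an entry can only violate conditions to the right and below, and there the immediate
neighbours are the binding ones. That the cell below lies in the diagram if any cell further down
does is where the partition shape matters.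
\<close>

lemma is_ssyt_raise_iff:
  assumes m: "part \<mu> \<in> shapes d" and T: "is_ssyt \<mu> T" and u: "u \<in> diagram \<mu>" and k: "T u \<le> k"
  shows "is_ssyt \<mu> (T(u := k)) \<longleftrightarrow> raisable (diagram \<mu>) T u k"
proof -
  obtain i j where ij: "u = (i, j)" by (cases u)
  note D = diagram_eq_cells[of \<mu>]
  have i1: "1 \<le> i" and j1: "1 \<le> j" using u by (auto simp: ij diagram_def)
  have row: "T (a, b) \<le> T (a, b')" if "(a, b) \<in> diagram \<mu>" "(a, b') \<in> diagram \<mu>" "b \<le> b'" for a b b'
    using T that unfolding is_ssyt_def by (cases "b = b'") auto
  have col: "T (a, b) < T (a', b)" if "(a, b) \<in> diagram \<mu>" "(a', b) \<in> diagram \<mu>" "a < a'" for a a' b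
    using T that unfolding is_ssyt_def by auto
  show ?thesis
  proof
    assume R: "is_ssyt \<mu> (T(u := k))"
    have "k \<le> T (i, Suc j)" if "(i, Suc j) \<in> diagram \<mu>"
    proof -
      have "(T(u := k)) (i, j) \<le> (T(u := k)) (i, Suc j)"
        using R that u unfolding is_ssyt_def ij by blast
      then show ?thesis by (simp add: ij)
    qed
    moreover have "k < T (Suc i, j)" if "(Suc i, j) \<in> diagram \<mu>"
    proof -
      have "(T(u := k)) (i, j) < (T(u := k)) (Suc i, j)"
        using R that u unfolding is_ssyt_def ij by blast
      then show ?thesis by (simp add: ij)
    qed
    ultimately show "raisable (diagram \<mu>) T u k" by (simp add: raisable_def ij)
  next
    assume R: "raisable (diagram \<mu>) T u k"
    have right: "k \<le> T (i, b)" if "(i, b) \<in> diagram \<mu>" "j < b" for b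
    proof -
      have "(i, Suc j) \<in> diagram \<mu>" using that unfolding D by (auto simp: cells_def)
      then show ?thesis using R row[of i "Suc j" b] that by (simp add: raisable_def ij)
    qed
    have below: "k < T (a, j)" if "(a, j) \<in> diagram \<mu>" "i < a" for a
    proof -
      have "part \<mu> a \<le> part \<mu> (Suc i)" by (rule shapes_antimono[OF m]) (use that in auto)
      then have "(Suc i, j) \<in> diagram \<mu>" using that unfolding D by (auto simp: cells_def)
      then show ?thesis using R col[of "Suc i" j a] that
        by (cases "a = Suc i") (auto simp: raisable_def ij)
    qed
    have left: "T (i, b) \<le> k" if "(i, b) \<in> diagram \<mu>" "b < j" for b
      using row[of i b j] that u k by (simp add: ij)
    have above: "T (a, j) < k" if "(a, j) \<in> diagram \<mu>" "a < i" for a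
      using col[of a j i] that u k by (simp add: ij)
    have "T(u := k) \<in> diagram \<mu> \<rightarrow>\<^sub>E {0<..}"
      using T u k unfolding is_ssyt_def by (auto simp: PiE_iff extensional_def)
    moreover have "(T(u := k)) (a, b) \<le> (T(u := k)) (a, b')"
      if "(a, b) \<in> diagram \<mu>" "(a, b') \<in> diagram \<mu>" "b < b'" for a b b'
      using that right[of b'] left[of b] row[of a b b'] by (auto simp: ij)
    moreover have "(T(u := k)) (a, b) < (T(u := k)) (a', b)"
      if "(a, b) \<in> diagram \<mu>" "(a', b) \<in> diagram \<mu>" "a < a'" for a a' b
      using that above[of a] below[of a'] col[of a b a'] by (auto simp: ij)
    ultimately show "is_ssyt \<mu> (T(u := k))" unfolding is_ssyt_def by blast
  qed
qed

lemma raisable_antimono: "raisable D T u k' \<Longrightarrow> k \<le> k' \<Longrightarrow> raisable D T u k"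
  by (auto simp: raisable_def)

text \<open>
The admissible values for an entry form an interval that starts at the entry itself, so comparison
with their maximum, or with \<open>\<infinity>\<close> if there is none, is admissibility.
\<close>

lemma le_max_entry_iff:
  assumes m: "part \<mu> \<in> shapes d" and T: "is_ssyt \<mu> T" and u: "u \<in> diagram \<mu>" and k: "T u < k"
  shows "enat k \<le> max_entry \<mu> T u \<longleftrightarrow> raisable (diagram \<mu>) T u k"
proof -
  define K where "K = {k. T u \<le> k \<and> is_ssyt \<mu> (T(u := k))}"
  have K: "l \<in> K \<longleftrightarrow> T u \<le> l \<and> raisable (diagram \<mu>) T u l" for l
    using is_ssyt_raise_iff[OF m T u] by (auto simp: K_def)
  have me: "max_entry \<mu> T u = (if finite K then enat (Max K) else \<infinity>)"
    by (simp add: max_entry_def K_def)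
  show ?thesis
  proof (cases "finite K")
    case True
    have "T u \<in> K" using T by (simp add: K_def)
    then have "Max K \<in> K" using True by (intro Max_in) auto
    then have "raisable (diagram \<mu>) T u k" if "k \<le> Max K"
      using raisable_antimono[OF _ that] K by blast
    moreover have "k \<le> Max K" if "raisable (diagram \<mu>) T u k"
      using that k True K by (intro Max_ge) auto
    ultimately show ?thesis using True by (auto simp: me)
  next
    case False
    then obtain l where "k \<le> l" "l \<in> K" using infinite_nat_iff_unbounded_le by blast
    then have "raisable (diagram \<mu>) T u k" using K raisable_antimono by blast
    then show ?thesis using False by (simp add: me)
  qed
qed

lemma pstar_product_eq_tweight:
  fixes lam \<mu> :: "nat list"
  defines "d \<equiv> length lam"
  assumes m: "part \<mu> \<in> shapes d" and T: "T \<in> SSYT \<mu> d"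
  shows "fls_X_intpow (pstar lam \<mu> T) * (\<Prod>u\<in>diagram \<mu>. 1 - fls_X_intpow (weight lam u (T u))) =
    tweight (fls_X :: rat fls) (\<lambda>k. int (part lam (Suc d - k))) d (diagram \<mu>) T"
proof -
  have pow_sum: "(fls_X :: rat fls) powi (\<Sum>i\<in>I. g i) = (\<Prod>i\<in>I. fls_X powi g i)" for g :: "'b \<Rightarrow> int" and I
    by (induction I rule: infinite_finite_induct) (simp_all add: power_int_add del: fls_X_power_int)
  have w: "weight lam u k = int (part lam (Suc d - k)) - content u" for u k
    by (simp add: weight_def d_def)
  have ssyt: "is_ssyt \<mu> T" using T by (simp add: SSYT_def)
  have "{k. T u < k \<and> enat k \<le> min (enat (length lam)) (max_entry \<mu> T u)} =
      {k. T u < k \<and> k \<le> d \<and> raisable (diagram \<mu>) T u k}" if "u \<in> diagram \<mu>" for u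
    using le_max_entry_iff[OF m ssyt that] by (auto simp: d_def)
  then have "fls_X powi pstar lam \<mu> T = (\<Prod>u\<in>diagram \<mu>.
      \<Prod>k | T u < k \<and> k \<le> d \<and> raisable (diagram \<mu>) T u k. (fls_X :: rat fls) powi weight lam u k)"
    unfolding pstar_def pow_sum by (intro prod.cong) auto
  then show ?thesis
    unfolding fls_X_power_int[symmetric] tweight_def prod.distrib w by (simp only: mult.commute)
qed

theorem theorem1p9:
  fixes lam \<mu> :: "nat list" and d :: nat
  assumes "is_partition lam" and "d = length lam"
    and "is_partition \<mu>" and "diagram \<mu> \<subseteq> diagram lam"
  shows "fps_to_fls (rpp (skew_diagram lam \<mu>)) / fps_to_fls (rpp (diagram lam)) =
    (\<Sum>T\<in>SSYT \<mu> d. fls_X_intpow (pstar lam \<mu> T) *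
       (\<Prod>u\<in>diagram \<mu>. 1 - fls_X_intpow (weight lam u (T u))))"
proof -
  have L: "part lam \<in> shapes d" using assms by (intro part_in_shapes) auto
  have "length \<mu> \<le> d"
  proof (cases "\<mu> = []")
    case False
    then have "0 < part \<mu> (length \<mu>)" using part_pos[OF assms(3)] by (cases \<mu>) auto
    then have "(length \<mu>, 1) \<in> diagram \<mu>" using False by (auto simp: diagram_def Suc_le_eq)
    then show ?thesis using assms by (auto simp: diagram_def)
  qed simp
  then have m: "part \<mu> \<in> shapes d" by (rule part_in_shapes[OF assms(3)])
  have le: "part \<mu> i \<le> part lam i" for i
    using assms(4) cells_mono_iff[of "part \<mu>" "part lam"] by (simp add: diagram_eq_cells part_def)
  have pos: "0 < part lam i" if "1 \<le> i" "i \<le> d" for i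
    using part_pos[OF assms(1) that(1)] that(2) assms(2) by simp
  have "(\<Sum>T\<in>SSYT \<mu> d. fls_X_intpow (pstar lam \<mu> T) *
       (\<Prod>u\<in>diagram \<mu>. 1 - fls_X_intpow (weight lam u (T u)))) =
     tabsum (fls_X :: rat fls) (\<lambda>k. int (part lam (Suc d - k))) d (part \<mu>)"
    unfolding tabsum_def diagram_eq_cells[symmetric] SSYT_eq_tabs[symmetric]
    using m by (intro sum.cong refl) (simp only: assms(2) pstar_product_eq_tweight)
  also have "\<dots> = fps_to_fls (rpp (skew_diagram lam \<mu>)) / fps_to_fls (rpp (diagram lam))"
    unfolding skew_diagram_def diagram_eq_cells
    using tabsum_eq_rpp_ratio[OF L _ m] pos le by simp
  finally show ?thesis ..
qed

end
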